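(* Let $B_X$ and $B_Z$ denote the orthonormal eigenbases of the operators $X$ and $Z$ on $\mathbb{C}^6$, respectively. Then there are exactly $48$ normalized vectors $|v\rangle\in\mathbb{C}^6$ whose first component is $v_1=1/\sqrt{6}$ such that $$|\langle w|v\rangle|^2=\tfrac16\qquad\text{for all } |w\rangle\in B_X\cup B_Z .$$ From these $48$ vectors one can construct $16$ different orthonormal bases $B_i$ $(i=1,\dots,16)$ of $\mathbb{C}^6$ such that the three bases in $\mathcal{MUB}_i:=\{B_X,B_Z,B_i\}$ are mutually unbiased. All $\mathcal{MUB}_i$ are maximal in the sense that there is no vector $|\psi\rangle\in\mathbb{C}^6$ that is unbiased with respect to all three bases in $\mathcal{MUB}_i$.
   Context: On $\mathbb{C}^6$ with standard basis $|0\rangle,\dots,|5\rangle$, let $\omega_6=\exp(2\pi i/6)$, $X=\sum_{j=0}^{5}|j+1 \bmod 6\rangle\langle j|$ and $Z=\sum_{j=0}^{5}\omega_6^j|j\rangle\langle j|$. Both operators have nondegenerate spectrum, so their orthonormal eigenbases are determined up to ordering and phases; $B_Z$ is the standard basis and $B_X$ consists of the vectors $\frac{1}{\sqrt6}\sum_{k}\omega_6^{jk}|k\rangle$. Orthonormal bases $B,B'$ of $\mathbb{C}^d$ are mutually unbiased if $|\langle\psi|\psi'\rangle|^2=1/d$ for all $|\psi\rangle\in B$, $|\psi'\rangle\in B'$. A (normalized) vector $|\psi\rangle\in\mathbb{C}^d$ is unbiased with respect to a set of vectors if $|\langle\psi|\psi_k\rangle|^2=1/d$ for every $|\psi_k\rangle$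 in the set. Bases are regarded as sets of vectors (not ordered). *)

theory Defs
  imports
    Complex_Main
    "Jordan_Normal_Form.Char_Poly"
    "Jordan_Normal_Form.VS_Connect"
    "Jordan_Normal_Form.Conjugate"
begin

text \<open>In \<open>v \<bullet>c w\<close> the \<^emph>\<open>second\<close> argument is conjugated, so the arguments are swapped here.\<close>

definition braket :: "complex vec \<Rightarrow> complex vec \<Rightarrow> complex" where
  "braket v w = w \<bullet>c v"

definition normalized :: "complex vec \<Rightarrow> bool" where
  "normalized v \<longleftrightarrow> braket v v = 1"

definition orthonormal_basis :: "nat \<Rightarrow> complex vec set \<Rightarrow> bool" where
  "orthonormal_basis d B \<longleftrightarrow>
     vectorspace.basis class_ring (module_vec TYPE(complex) d) B \<and>
     (\<forall>v\<in>B. normalized v) \<and>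
     (\<forall>v\<in>B. \<forall>w\<in>B. v \<noteq> w \<longrightarrow> braket v w = 0)"

definition orthonormal_eigenbasis :: "nat \<Rightarrow> complex mat \<Rightarrow> complex vec set \<Rightarrow> bool" where
  "orthonormal_eigenbasis d A B \<longleftrightarrow>
     A \<in> carrier_mat d d \<and> orthonormal_basis d B \<and> (\<forall>v\<in>B. \<exists>k. eigenvector A v k)"

definition unbiased :: "nat \<Rightarrow> complex vec \<Rightarrow> complex vec set \<Rightarrow> bool" where
  "unbiased d v S \<longleftrightarrow>
     v \<in> carrier_vec d \<and> normalized v \<and> (\<forall>w\<in>S. (cmod (braket w v))\<^sup>2 = 1 / real d)"

definition mutually_unbiased :: "nat \<Rightarrow> complex vec set \<Rightarrow> complex vec set \<Rightarrow> bool" where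
  "mutually_unbiased d B B' \<longleftrightarrow>
     orthonormal_basis d B \<and> orthonormal_basis d B' \<and>
     (\<forall>v\<in>B. \<forall>w\<in>B'. (cmod (braket v w))\<^sup>2 = 1 / real d)"

definition omega6 :: complex where
  "omega6 = exp (2 * of_real pi * \<i> / 6)"

definition op_X :: "complex mat" where
  "op_X = mat 6 6 (\<lambda>(i, j). if i = (j + 1) mod 6 then 1 else 0)"

definition op_Z :: "complex mat" where
  "op_Z = mat 6 6 (\<lambda>(i, j). if i = j then omega6 ^ j else 0)"

text \<open>An orthonormal eigenbasis is only determined up to the phases of its vectors; the two sets
  below are the customary representatives, the Fourier basis for \<open>op_X\<close> and the standard basis
  for \<open>op_Z\<close>.\<close>

definition fourier_vec :: "nat \<Rightarrow> complex vec" where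
  "fourier_vec j = vec 6 (\<lambda>k. omega6 ^ (j * k) / of_real (sqrt 6))"

definition basis_X :: "complex vec set" where
  "basis_X = fourier_vec ` {..<6}"

definition basis_Z :: "complex vec set" where
  "basis_Z = unit_vec 6 ` {..<6}"

lemma braket_sum:
  assumes "v \<in> carrier_vec d"
  shows "braket v w = (\<Sum>k<d. cnj (v $ k) * w $ k)"
  using assms unfolding braket_def scalar_prod_def
  by (auto simp: lessThan_atLeast0 mult.commute intro!: sum.cong)

lemma orthonormal_basisI:
  assumes B: "B \<subseteq> carrier_vec d" and finB: "finite B" and card: "card B = d"
    and norm: "\<And>v. v \<in> B \<Longrightarrow> normalized v"
    and orth: "\<And>v w. v \<in> B \<Longrightarrow> w \<in> B \<Longrightarrow> v \<noteq> w \<Longrightarrow> braket v w = 0"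
  shows "orthonormal_basis d B"
proof -
  interpret vec_space "TYPE(complex)" d .
  have li: "lin_indpt B"
  proof (rule finite_lin_indpt2[OF finB B])
    fix a assume z: "lincomb a B = 0\<^sub>v d"
    show "\<forall>v\<in>B. a v = 0"
    proof
      fix v assume v: "v \<in> B"
      have vc: "v \<in> carrier_vec d" using v B by auto
      have "0 = braket v (lincomb a B)"
        using z vc by (simp add: braket_sum)
      also have "\<dots> = (\<Sum>k<d. \<Sum>w\<in>B. cnj (v $ k) * (a w * w $ k))"
        by (simp add: braket_sum[OF vc] lincomb_index[OF _ B] sum_distrib_left)
      also have "\<dots> = (\<Sum>w\<in>B. \<Sum>k<d. cnj (v $ k) * (a w * w $ k))"
        by (rule sum.swap)
      also have "\<dots> = (\<Sum>w\<in>B. a w * braket v w)"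
        by (simp add: braket_sum[OF vc] sum_distrib_left mult_ac)
      also have "\<dots> = (\<Sum>w\<in>B. if w = v then a v else 0)"
        using norm[OF v] orth[OF v] by (intro sum.cong) (auto simp: normalized_def)
      also have "\<dots> = a v" using finB v by simp
      finally show "a v = 0" by simp
    qed
  qed
  have "basis B"
    using dim_li_is_basis[OF fin_dim finB B li] card dim_is_n by simp
  then show ?thesis
    unfolding orthonormal_basis_def using norm orth by blast
qed

lemma omega6_eq: "omega6 = Complex (1/2) (sqrt 3 / 2)"
proof -
  have "omega6 = cis (pi / 3)"
    unfolding omega6_def cis_conv_exp by (simp add: field_simps)
  then show ?thesis by (simp add: complex_eq_iff cos_60 sin_60)
qed

lemma omega6_powers:
  shows "omega6 ^ 2 = omega6 - 1" and "omega6 ^ 3 = -1" and "omega6 ^ 4 = - omega6"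
    and "omega6 ^ 5 = 1 - omega6" and "omega6 ^ 6 = 1"
proof -
  show 2: "omega6 ^ 2 = omega6 - 1"
    by (simp add: omega6_eq complex_eq_iff power2_eq_square)
  show 3: "omega6 ^ 3 = -1"
  proof -
    have "omega6 ^ 3 = omega6 * omega6 ^ 2" by (simp add: power2_eq_square power3_eq_cube)
    also have "\<dots> = omega6 * omega6 - omega6" by (simp add: 2 right_diff_distrib)
    also have "\<dots> = -1" using 2 by (simp add: power2_eq_square)
    finally show ?thesis .
  qed
  show 4: "omega6 ^ 4 = - omega6"
    using 3 by (simp add: power3_eq_cube power4_eq_xxxx)
  show "omega6 ^ 5 = 1 - omega6"
    using 2 4 by (simp add: eval_nat_numeral algebra_simps)
  have "omega6 ^ 6 = (omega6 ^ 3) ^ 2" by (simp flip: power_mult)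
  then show "omega6 ^ 6 = 1" using 3 by simp
qed

lemma omega6_mod: "omega6 ^ n = omega6 ^ (n mod 6)"
proof -
  have "omega6 ^ n = omega6 ^ (6 * (n div 6) + n mod 6)" by simp
  also have "\<dots> = omega6 ^ (n mod 6)"
    by (simp only: power_add power_mult omega6_powers) simp
  finally show ?thesis .
qed

lemma cnj_omega6: "cnj omega6 = omega6 ^ 5"
  unfolding omega6_powers(4) by (simp add: omega6_eq complex_eq_iff)

lemma braket_fourier:
  assumes "i < 6" "j < 6"
  shows "braket (fourier_vec i) (fourier_vec j) = (if i = j then 1 else 0)"
proof -
  have s: "complex_of_real (sqrt 6) * complex_of_real (sqrt 6) = 6"
    by (simp flip: of_real_mult)
  define q where "q = omega6 ^ (5 * i + j)"
  have "braket (fourier_vec i) (fourier_vec j) = (\<Sum>k<6. q ^ k / 6)"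
    by (subst braket_sum[of _ 6])
       (auto simp: fourier_vec_def cnj_omega6 s q_def power_add power_mult_distrib
         mult.assoc intro!: sum.cong simp flip: power_mult)
  also have "\<dots> = (\<Sum>k<6. q ^ k) / 6"
    by (simp only: sum_divide_distrib)
  also have "\<dots> = (if i = j then 1 else 0)"
  proof (cases "i = j")
    case True
    have "q = (omega6 ^ 6) ^ i" unfolding q_def True by (simp flip: power_mult)
    then show ?thesis using True by (simp add: omega6_powers)
  next
    case False
    define m where "m = (5 * i + j) mod 6"
    have "i \<in> {0,1,2,3,4,5}" "j \<in> {0,1,2,3,4,5}" using assms by auto
    then have "m \<noteq> 0" using False unfolding m_def by (elim insertE emptyE) simp_all
    moreover have "m < 6" by (simp add: m_def)
    ultimately have "m \<in> {1,2,3,4,5}" by auto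
    then have "omega6 ^ m \<noteq> 1"
      by (elim insertE emptyE) (simp_all add: omega6_powers, simp_all add: omega6_eq complex_eq_iff)
    then have "q \<noteq> 1" unfolding q_def m_def using omega6_mod[of "5 * i + j"] by argo
    moreover have "q ^ 6 = 1"
    proof -
      have "q ^ 6 = (omega6 ^ 6) ^ (5 * i + j)"
        unfolding q_def by (simp only: power_mult[symmetric] mult.commute)
      then show ?thesis by (simp add: omega6_powers)
    qed
    ultimately show ?thesis using False by (simp add: geometric_sum)
  qed
  finally show ?thesis .
qed

lemma orthonormal_eigenbasis_X: "orthonormal_eigenbasis 6 op_X basis_X"
proof -
  have inj: "inj_on fourier_vec {..<6}"
  proof (rule inj_onI)
    fix i j assume ij: "i \<in> {..<6}" "j \<in> {..<6}" and eq: "fourier_vec i = fourier_vec j"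
    have "braket (fourier_vec i) (fourier_vec j) = 1"
      unfolding eq using ij by (simp add: braket_fourier)
    then show "i = j" using ij by (simp add: braket_fourier split: if_splits)
  qed
  have onb: "orthonormal_basis 6 basis_X"
  proof (rule orthonormal_basisI)
    show "basis_X \<subseteq> carrier_vec 6" by (auto simp: basis_X_def fourier_vec_def)
    show "card basis_X = 6" unfolding basis_X_def by (simp add: card_image[OF inj])
  qed (auto simp: basis_X_def normalized_def braket_fourier)
  have "eigenvector op_X (fourier_vec j) (omega6 ^ (5 * j))" if j: "j < 6" for j
  proof -
    have "fourier_vec j \<noteq> 0\<^sub>v 6"
    proof
      assume z: "fourier_vec j = 0\<^sub>v 6"
      have "braket (fourier_vec j) (fourier_vec j) = 0"
        unfolding z by (simp add: braket_sum[of _ 6])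
      then show False using j by (simp add: braket_fourier)
    qed
    moreover have "op_X *\<^sub>v fourier_vec j = omega6 ^ (5 * j) \<cdot>\<^sub>v fourier_vec j"
    proof (rule eq_vecI)
      fix i assume "i < dim_vec (omega6 ^ (5 * j) \<cdot>\<^sub>v fourier_vec j)"
      then have i: "i < 6" by (simp add: fourier_vec_def)
      have dims: "dim_row op_X = 6" "dim_col op_X = 6" "dim_vec (fourier_vec j) = 6"
        by (simp_all add: op_X_def fourier_vec_def)
      have "(op_X *\<^sub>v fourier_vec j) $ i = (\<Sum>k = 0..<6. op_X $$ (i, k) * fourier_vec j $ k)"
        using i dims by (simp only: index_mult_mat_vec scalar_prod_def row_def dim_vec index_vec)
          (rule sum.cong, auto)
      also have "\<dots> = (\<Sum>k = 0..<6. if k = (i + 5) mod 6 then fourier_vec j $ k else 0)"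
      proof (rule sum.cong[OF refl])
        fix k :: nat assume "k \<in> {0..<6}"
        then have k: "k < 6" by simp
        have "i \<in> {0,1,2,3,4,5}" "k \<in> {0,1,2,3,4,5}" using i k by auto
        then have "i = (k + 1) mod 6 \<longleftrightarrow> k = (i + 5) mod 6"
          by (elim insertE) simp_all
        then show "op_X $$ (i, k) * fourier_vec j $ k =
            (if k = (i + 5) mod 6 then fourier_vec j $ k else 0)"
          using i k unfolding op_X_def by simp
      qed
      also have "\<dots> = fourier_vec j $ ((i + 5) mod 6)" by simp
      also have "\<dots> = omega6 ^ (j * ((i + 5) mod 6)) / of_real (sqrt 6)"
        by (simp add: fourier_vec_def)
      also have "omega6 ^ (j * ((i + 5) mod 6)) = omega6 ^ (j * (i + 5))"
        using omega6_mod[of "j * ((i + 5) mod 6)"] omega6_mod[of "j * (i + 5)"]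
        by (simp only: mod_mult_right_eq)
      also have "\<dots> = omega6 ^ (5 * j) * omega6 ^ (j * i)"
        by (simp add: algebra_simps flip: power_add)
      finally show "(op_X *\<^sub>v fourier_vec j) $ i = (omega6 ^ (5 * j) \<cdot>\<^sub>v fourier_vec j) $ i"
        using i by (simp add: fourier_vec_def)
    qed (simp add: op_X_def fourier_vec_def)
    ultimately show ?thesis
      by (simp add: eigenvector_def op_X_def) (simp add: fourier_vec_def)
  qed
  then show ?thesis
    using onb by (auto simp: orthonormal_eigenbasis_def basis_X_def) (simp add: op_X_def)
qed

lemma orthonormal_eigenbasis_Z: "orthonormal_eigenbasis 6 op_Z basis_Z"
proof -
  have br: "braket (unit_vec 6 i) (unit_vec 6 j) = (if i = j then 1 else 0)"
    if "i < 6" "j < 6" for i j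
  proof -
    have "braket (unit_vec 6 i) (unit_vec 6 j) = (\<Sum>k<6. if k = i then if i = j then 1 else 0 else 0)"
      unfolding braket_sum[OF unit_vec_carrier] using that by (intro sum.cong) auto
    then show ?thesis using that by simp
  qed
  have inj: "inj_on (unit_vec 6 :: nat \<Rightarrow> complex vec) {..<6}"
    by (rule inj_onI) simp
  have onb: "orthonormal_basis 6 basis_Z"
  proof (rule orthonormal_basisI)
    show "basis_Z \<subseteq> carrier_vec 6" by (auto simp: basis_Z_def)
    show "card basis_Z = 6" unfolding basis_Z_def by (simp add: card_image[OF inj])
  qed (auto simp: basis_Z_def normalized_def br)
  have "eigenvector op_Z (unit_vec 6 j) (omega6 ^ j)" if "j < 6" for j
    using that unfolding eigenvector_def op_Z_def
    by auto
  then show ?thesis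
    using onb by (auto simp: orthonormal_eigenbasis_def basis_Z_def) (simp add: op_Z_def)
qed

end

theory Submission
  imports Defs
begin

text \<open>
  Write \<open>\<int>\<^sub>6 = \<int>\<^sub>2 \<times> \<int>\<^sub>3\<close>. A vector with unimodular entries \<open>u\<^sub>k\<close> consists of three pairs
  \<open>(p\<^sub>b, q\<^sub>b) = (g\<^sub>b h\<^sub>b, g\<^sub>b cnj h\<^sub>b)\<close>, where \<open>b = k mod 3\<close> and \<open>h\<^sub>b\<close> is a square root of \<open>p\<^sub>b / q\<^sub>b\<close>. The
  Fourier transform over \<open>\<int>\<^sub>2\<close> separates the real parts \<open>c\<^sub>b\<close> and imaginary parts \<open>s\<^sub>b\<close> of \<open>h\<^sub>b\<close>, and
  with \<open>d\<^sub>b = g\<^sub>b cnj g\<^sub>b\<^sub>+\<^sub>1\<close> flatness of the whole transform becomes \<open>\<Sum> c\<^sub>b\<^sup>2 = 3/2\<close>,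
  \<open>\<Sum> d\<^sub>b c\<^sub>b c\<^sub>b\<^sub>+\<^sub>1 = 0\<close> and \<open>\<Sum> d\<^sub>b s\<^sub>b s\<^sub>b\<^sub>+\<^sub>1 = 0\<close>: two linear relations with real coefficients
  between three unimodular numbers of product 1. If the \<open>d\<^sub>b\<close> are not all parallel over the reals,
  the two relations are proportional; this forces all \<open>h\<^sub>b\<close> to be equal up to sign and gives 12
  solutions. If they are parallel, the signs can be moved into \<open>g\<close> and \<open>h\<close> so that the \<open>d\<^sub>b\<close> equal one
  cube root of unity, and the \<open>h\<^sub>b\<close> are, up to a common phase, a permutation of \<open>1, \<kappa>, cnj \<kappa>\<close> with
  \<open>Re \<kappa> = (sqrt 3 - 1) / 2\<close>; this gives 36 solutions.

  Orthogonality of the 48 vectors is then decided by integer arithmetic, because 1 and \<open>Re \<kappa>\<close> are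
  linearly independent over the rationals. The orthogonality graph has 16 cliques of size 6, and
  every vertex lies in, or is adjacent to a vertex of, each of them. So a vector that is unbiased
  to \<open>B\<^sub>X\<close> and \<open>B\<^sub>Z\<close> is parallel or orthogonal to some vector of each of the 16 bases.
\<close>

section \<open>Eigenbases of \<open>op_X\<close> and \<open>op_Z\<close>\<close>

lemma orthonormal_basisD:
  assumes "orthonormal_basis d B"
  shows "B \<subseteq> carrier_vec d" "finite B" "card B = d"
proof -
  interpret vec_space "TYPE(complex)" d .
  have b: "basis B" using assms by (simp add: orthonormal_basis_def)
  then show B: "B \<subseteq> carrier_vec d" by (simp add: basis_def)
  have li: "lin_indpt B" using b by (simp add: basis_def)
  show fin: "finite B" using fin_dim_li_fin[OF fin_dim li] B by simp
  show "card B = d" using dim_basis[OF fin b] dim_is_n by simp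
qed

lemma braket_smult:
  assumes "v \<in> carrier_vec d" "w \<in> carrier_vec d"
  shows "braket (c \<cdot>\<^sub>v v) w = cnj c * braket v w" "braket v (c \<cdot>\<^sub>v w) = c * braket v w"
  using assms by (auto simp: braket_sum[of _ d] sum_distrib_left mult_ac intro!: sum.cong)

text \<open>An eigenbasis is determined only up to phases and order. Each basis vector
  \<open>w\<close> is \<open>C w\<close> times some \<open>F (J w)\<close>: normalization gives
  \<open>cmod (C w) = 1\<close>, orthogonality makes \<open>J\<close> injective, and counting makes
  it onto. Phases do not affect moduli, so fixed reference vectors can replace an arbitrary
  eigenbasis.\<close>

lemma eigenbasis_rays:
  assumes B: "orthonormal_eigenbasis d A B"
    and F: "\<And>j. j < d \<Longrightarrow> F j \<in> carrier_vec d" "\<And>j. j < d \<Longrightarrow> normalized (F j)"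
    and eig: "\<And>w k. eigenvector A w k \<Longrightarrow> \<exists>j<d. \<exists>c. w = c \<cdot>\<^sub>v F j"
    and v: "v \<in> carrier_vec d"
  shows "(\<forall>w\<in>B. P (cmod (braket w v))) \<longleftrightarrow> (\<forall>j<d. P (cmod (braket (F j) v)))"
proof -
  have onb: "orthonormal_basis d B" using B by (simp add: orthonormal_eigenbasis_def)
  have "\<exists>j c. j < d \<and> w = c \<cdot>\<^sub>v F j" if "w \<in> B" for w
    using B eig that unfolding orthonormal_eigenbasis_def by blast
  then obtain J C where J: "\<And>w. w \<in> B \<Longrightarrow> J w < d"
    and C: "\<And>w. w \<in> B \<Longrightarrow> w = C w \<cdot>\<^sub>v F (J w)" by metis
  have br: "braket w x = cnj (C w) * braket (F (J w)) x" if "w \<in> B" "x \<in> carrier_vec d" for w x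
    using braket_smult(1)[OF F(1)[OF J[OF that(1)]] that(2)] C[OF that(1)] by metis
  have brr: "braket w x = C x * cnj (C w) * braket (F (J w)) (F (J x))" if "w \<in> B" "x \<in> B" for w x
    using br[OF that(1) F(1)[OF J[OF that(2)]]] C[OF that(2)]
      braket_smult(2)[of w d "F (J x)" "C x"] F(1)[OF J[OF that(2)]]
      orthonormal_basisD(1)[OF onb] that by (metis mult.assoc subsetD)
  have unit: "cmod (C w) = 1" if "w \<in> B" for w
  proof -
    have "1 = C w * cnj (C w)"
      using brr[OF that that] F(2)[OF J[OF that]] onb that
      by (simp add: orthonormal_basis_def normalized_def)
    then show ?thesis by (metis complex_mod_cnj norm_mult norm_one power2_eq_square power2_eq_1_iff
      norm_ge_zero neg_0_le_iff_le not_one_le_zero)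
  qed
  have "inj_on J B"
  proof (rule inj_onI, rule ccontr)
    fix w x assume wx: "w \<in> B" "x \<in> B" "J w = J x" "w \<noteq> x"
    have "braket w x = 0" using onb wx by (simp add: orthonormal_basis_def)
    then show False using brr[OF wx(1,2)] wx unit[OF wx(1)] unit[OF wx(2)] F(2)[OF J[OF wx(2)]]
      by (auto simp: normalized_def)
  qed
  then have "card (J ` B) = d" using orthonormal_basisD[OF onb] by (simp add: card_image)
  moreover have "J ` B \<subseteq> {..<d}" using J by auto
  ultimately have JB: "J ` B = {..<d}" by (simp add: card_subset_eq)
  have eq: "cmod (braket w v) = cmod (braket (F (J w)) v)" if "w \<in> B" for w
    using br[OF that v] unit[OF that] by (simp add: norm_mult)
  have "(\<forall>w\<in>B. P (cmod (braket w v))) \<longleftrightarrow> (\<forall>j\<in>J ` B. P (cmod (braket (F j) v)))"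
    using eq by auto
  then show ?thesis unfolding JB by (simp add: Ball_def)
qed

lemma less_six_cases: "i \<in> {0,1,2,3,4,5}" if "i < 6" for i :: nat
  using that by auto

lemma omega6_power_inject:
  assumes "i < 6" "j < 6" "omega6 ^ i = omega6 ^ j"
  shows "i = j"
proof -
  have "i \<in> {0,1,2,3,4,5}" "j \<in> {0,1,2,3,4,5}" using assms by auto
  then show ?thesis using assms(3)
    by (elim insertE emptyE) (simp_all add: omega6_powers, simp_all add: omega6_eq complex_eq_iff)
qed

lemma eigenvector_op_Z:
  assumes "eigenvector op_Z w k"
  shows "\<exists>j<6. \<exists>c. w = c \<cdot>\<^sub>v unit_vec 6 j"
proof -
  have w: "w \<in> carrier_vec 6" "w \<noteq> 0\<^sub>v 6" "op_Z *\<^sub>v w = k \<cdot>\<^sub>v w"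
    using assms by (auto simp: eigenvector_def op_Z_def)
  have ev: "omega6 ^ i * w $ i = k * w $ i" if "i < 6" for i
  proof -
    have "(op_Z *\<^sub>v w) $ i = (\<Sum>l = 0..<6. (if i = l then omega6 ^ l else 0) * w $ l)"
      using that w(1) by (simp add: op_Z_def scalar_prod_def)
    also have "\<dots> = (\<Sum>l = 0..<6. if i = l then omega6 ^ l * w $ l else 0)"
      by (rule sum.cong) auto
    also have "\<dots> = omega6 ^ i * w $ i" using that by simp
    finally have "(op_Z *\<^sub>v w) $ i = omega6 ^ i * w $ i" .
    moreover have "(op_Z *\<^sub>v w) $ i = k * w $ i" using w that by simp
    ultimately show ?thesis by argo
  qed
  obtain j where j: "j < 6" "w $ j \<noteq> 0"
    using w(1,2) by (metis eq_vecI carrier_vecD index_zero_vec)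
  have "w $ i = 0" if "i < 6" "i \<noteq> j" for i
    
  proof (rule ccontr)
    assume "w $ i \<noteq> 0"
    then have "omega6 ^ i = k" using ev[OF that(1)] by simp
    moreover have "omega6 ^ j = k" using ev[OF j(1)] j(2) by simp
    ultimately have "omega6 ^ i = omega6 ^ j" by simp
    then show False using omega6_power_inject[OF that(1) j(1)] that(2) by simp
  qed
  then have "w = w $ j \<cdot>\<^sub>v unit_vec 6 j"
    using w(1) j(1) by (intro eq_vecI) (auto simp: unit_vec_def)
  then show ?thesis using j(1) by blast
qed

text \<open>\<open>z ^ 6 - 1\<close> splits into linear factors at 1, \<open>omega6\<close>,
  \<open>omega6 ^ 2\<close> and their negatives. Replacing \<open>omega6\<close> by any
  \<open>w\<close> with \<open>w ^ 2 = w - 1\<close> makes the expansion purely polynomial.\<close>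

lemma sixth_root_of_unity:
  assumes "(z::complex) ^ 6 = 1"
  shows "\<exists>j<6. z = omega6 ^ j"
proof -
  have factor: "(z - 1) * (z + 1) * (z - w) * (z + w) * (z - (w - 1)) * (z + (w - 1)) = z ^ 6 - 1"
    if "w ^ 2 = w - 1" for w
  proof -
    have "(z - 1) * (z + 1) * (z - w) * (z + w) * (z - (w - 1)) * (z + (w - 1))
        = (z\<^sup>2 - 1) * ((z\<^sup>2 - w\<^sup>2) * (z\<^sup>2 - (w\<^sup>2 - 2 * w + 1)))"
      by (simp add: power2_eq_square algebra_simps)
    also have "\<dots> = (z\<^sup>2 - 1) * (z\<^sup>2 * z\<^sup>2 + z\<^sup>2 - (w\<^sup>2 - w))"
      using that by Groebner_Basis.algebra
    also have "\<dots> = z ^ 6 - 1"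
      unfolding that by (simp add: eval_nat_numeral algebra_simps)
    finally show ?thesis .
  qed
  have "(z - 1) * (z + 1) * (z - omega6) * (z + omega6) * (z - omega6 ^ 2) * (z + omega6 ^ 2) = z^6 - 1"
    using factor[OF omega6_powers(1)] by (simp add: omega6_powers(1))
  also have "z ^ 6 - 1 = 0" using assms by simp
  finally have "z = 1 \<or> z = - 1 \<or> z = omega6 \<or> z = - omega6 \<or> z = omega6 ^ 2 \<or> z = - (omega6 ^ 2)"
    by (simp only: mult_eq_0_iff disj_assoc right_minus_eq flip: eq_neg_iff_add_eq_0)
  then have "z = omega6 ^ 0 \<or> z = omega6 ^ 3 \<or> z = omega6 ^ 1 \<or> z = omega6 ^ 4 \<or> z = omega6 ^ 2 \<or> z = omega6 ^ 5"
    by (auto simp: omega6_powers)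
  moreover have "(0::nat) < 6" "(3::nat) < 6" "(1::nat) < 6" "(4::nat) < 6" "(2::nat) < 6" "(5::nat) < 6" by auto
  ultimately show ?thesis by blast
qed

text \<open>\<open>op_X\<close> is the cyclic shift, so each entry is \<open>k\<close> times its
  successor (\<open>i + 5\<close> is \<open>i - 1\<close> modulo 6). Going once around gives
  \<open>k ^ 6 = 1\<close>, and the entries are powers of \<open>inverse k\<close> up to the factor
  \<open>w $ 0\<close>.\<close>

lemma eigenvector_op_X:
  assumes "eigenvector op_X w k"
  shows "\<exists>j<6. \<exists>c. w = c \<cdot>\<^sub>v fourier_vec j"
proof -
  have w: "w \<in> carrier_vec 6" "w \<noteq> 0\<^sub>v 6" "op_X *\<^sub>v w = k \<cdot>\<^sub>v w"
    using assms by (auto simp: eigenvector_def op_X_def)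
  have ev: "w $ ((i + 5) mod 6) = k * w $ i" if "i < 6" for i
  proof -
    have "(op_X *\<^sub>v w) $ i = (\<Sum>l = 0..<6. (if i = (l + 1) mod 6 then 1 else 0) * w $ l)"
      using that w(1) by (simp add: op_X_def scalar_prod_def)
    also have "\<dots> = (\<Sum>l = 0..<6. if l = (i + 5) mod 6 then w $ l else 0)"
    proof (rule sum.cong[OF refl])
      fix l :: nat assume "l \<in> {0..<6}"
      then have "l \<in> {0,1,2,3,4,5}" "i \<in> {0,1,2,3,4,5}" using that by auto
      then have "i = (l + 1) mod 6 \<longleftrightarrow> l = (i + 5) mod 6" by (elim insertE) simp_all
      then show "(if i = (l + 1) mod 6 then 1 else 0) * w $ l = (if l = (i + 5) mod 6 then w $ l else 0)"
        by simp
    qed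
    also have "\<dots> = w $ ((i + 5) mod 6)" by simp
    finally show ?thesis using w that by simp
  qed
  have e: "w $ 5 = k * w $ 0" "w $ 0 = k * w $ 1" "w $ 1 = k * w $ 2" "w $ 2 = k * w $ 3"
    "w $ 3 = k * w $ 4" "w $ 4 = k * w $ 5"
    using ev[of 0] ev[of 1] ev[of 2] ev[of 3] ev[of 4] ev[of 5] by simp_all
  have "w $ 0 \<noteq> 0"
  proof
    assume "w $ 0 = 0"
    then have "w $ i = 0" if "i \<in> {0,1,2,3,4,5}" for i using that e by auto
    then have "w $ i = 0" if "i < 6" for i using that less_six_cases[OF that] by simp
    then have "w = 0\<^sub>v 6" using w(1) by (intro eq_vecI) auto
    then show False using w by simp
  qed
  have "w $ 0 = k * (k * (k * (k * (k * (k * w $ 0)))))" using e by metis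
  then have k6: "k ^ 6 = 1" using \<open>w $ 0 \<noteq> 0\<close> by (simp add: eval_nat_numeral)
  then have "k \<noteq> 0" by auto
  then have "(inverse k) ^ 6 = 1" using k6 by (simp add: power_inverse)
  then obtain j where j: "j < 6" "inverse k = omega6 ^ j" using sixth_root_of_unity by blast
  have st: "y = inverse k * x" if "x = k * y" for x y using that \<open>k \<noteq> 0\<close> by simp
  have wi: "w $ i = inverse k ^ i * w $ 0" if "i \<in> {0,1,2,3,4,5}" for i
    using that st[OF e(2)] st[OF e(3)] st[OF e(4)] st[OF e(5)] st[OF e(6)]
    by (elim insertE emptyE) (simp_all add: eval_nat_numeral)
  have "w = (w $ 0 * sqrt 6) \<cdot>\<^sub>v fourier_vec j"
  proof (rule eq_vecI)
    fix i assume "i < dim_vec ((w $ 0 * sqrt 6) \<cdot>\<^sub>v fourier_vec j)"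
    then have i: "i < 6" by (simp add: fourier_vec_def)
    show "w $ i = ((w $ 0 * sqrt 6) \<cdot>\<^sub>v fourier_vec j) $ i"
      unfolding wi[OF less_six_cases[OF i]] using i
      by (simp add: j(2) fourier_vec_def power_mult)
  qed (use w(1) in \<open>simp add: fourier_vec_def\<close>)
  then show ?thesis using j(1) by blast
qed

section \<open>Cliques\<close>

text \<open>A clique is listed by its earliest vertex in \<open>xs\<close>, so it occurs only once,
  as a sublist of \<open>xs\<close>; \<open>E\<close> is tested only from earlier to later
  vertices.\<close>

fun cliques :: "('a \<Rightarrow> 'a \<Rightarrow> bool) \<Rightarrow> nat \<Rightarrow> 'a list \<Rightarrow> 'a list list" where
  "cliques E 0 xs = [[]]"
| "cliques E (Suc n) [] = []"
| "cliques E (Suc n) (x # xs) = map ((#) x) (cliques E n (filter (E x) xs)) @ cliques E (Suc n) xs"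

definition is_clique :: "('a \<Rightarrow> 'a \<Rightarrow> bool) \<Rightarrow> nat \<Rightarrow> 'a set \<Rightarrow> bool" where
  "is_clique E n C \<longleftrightarrow> finite C \<and> card C = n \<and> (\<forall>x\<in>C. \<forall>y\<in>C. x \<noteq> y \<longrightarrow> E x y)"

lemma cliques_subset: "c \<in> set (cliques E n xs) \<Longrightarrow> set c \<subseteq> set xs"
  by (induction E n xs arbitrary: c rule: cliques.induct) fastforce+

text \<open>A clique in \<open>x # xs\<close> either avoids \<open>x\<close>, or is \<open>x\<close>
  together with a clique among the neighbours of \<open>x\<close>. Symmetry of \<open>E\<close>
  supplies the direction that the enumeration does not test.\<close>

lemma set_cliques:
  assumes "\<And>x y. x \<in> set xs \<Longrightarrow> y \<in> set xs \<Longrightarrow> E x y \<Longrightarrow> E y x" "distinct xs"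
  shows "set ` set (cliques E n xs) = {C. C \<subseteq> set xs \<and> is_clique E n C}"
  using assms
proof (induction E n xs rule: cliques.induct)
  case (1 E xs)
  then show ?case by (auto simp: is_clique_def)
next
  case (2 E n)
  then show ?case by (auto simp: is_clique_def)
next
  case (3 E n x xs)
  let ?K = "\<lambda>n S. {C. C \<subseteq> S \<and> is_clique E n C}"
  have "?K (Suc n) (set (x # xs)) = insert x ` ?K n (set (filter (E x) xs)) \<union> ?K (Suc n) (set xs)"
    (is "?L = ?R1 \<union> ?R2")
  proof (intro equalityI subsetI)
    fix C assume C: "C \<in> ?L"
    show "C \<in> ?R1 \<union> ?R2"
    proof (cases "x \<in> C")
      case True
      then have "C - {x} \<in> ?K n (set (filter (E x) xs))"
        using C by (auto simp: is_clique_def)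
      then have "insert x (C - {x}) \<in> ?R1" by blast
      then show ?thesis using True by (simp add: insert_absorb)
    qed (use C in auto)
  next
    fix C assume "C \<in> ?R1 \<union> ?R2"
    then show "C \<in> ?L"
    proof
      assume "C \<in> ?R1"
      then obtain D where D: "C = insert x D" "D \<subseteq> set (filter (E x) xs)" "is_clique E n D" by auto
      then have "x \<notin> D" using 3(4) by auto
      then have "card C = Suc n" using D by (simp add: is_clique_def)
      moreover have "E x y \<and> E y x" if "y \<in> D" for y
        using D(2) that 3(3)[of x y] by auto
      ultimately show ?thesis using D unfolding is_clique_def by auto
    qed auto
  qed
  moreover have "set ` set (cliques E n (filter (E x) xs)) = ?K n (set (filter (E x) xs))"
    by (rule "3.IH"(1)) (use "3.prems" in \<open>auto\<close>)
  moreover have "set ` set (cliques E (Suc n) xs) = ?K (Suc n) (set xs)"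
    by (rule "3.IH"(2)) (use "3.prems" in auto)
  moreover have "set ` set (cliques E (Suc n) (x # xs))
      = insert x ` (set ` set (cliques E n (filter (E x) xs))) \<union> set ` set (cliques E (Suc n) xs)"
    by (simp add: image_Un image_image)
  ultimately show ?case by (simp only:)
qed

text \<open>No set is produced by two different lists, so the length of the enumeration counts
  cliques as sets.\<close>

lemma distinct_map_set_cliques:
  assumes "distinct xs"
  shows "distinct (map set (cliques E n xs))"
  using assms
proof (induction E n xs rule: cliques.induct)
  case (3 E n x xs)
  let ?A = "cliques E n (filter (E x) xs)"
  have x: "x \<notin> set c" if "c \<in> set ?A" for c
    using cliques_subset[OF that] 3(3) by auto
  have "inj_on (insert x) (set ` set ?A)"
    using x by (intro inj_onI) (auto dest!: insert_ident[THEN iffD1, rotated 2])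
  moreover have "map set (map ((#) x) ?A) = map (insert x) (map set ?A)" by simp
  moreover have "distinct (map set ?A)" using 3 by simp
  ultimately have "distinct (map set (map ((#) x) ?A))"
    by (metis distinct_map set_map)
  moreover have "x \<notin> set c" if "c \<in> set (cliques E (Suc n) xs)" for c
    using cliques_subset[OF that] 3(3) by auto
  ultimately show ?case using 3 by auto
qed auto

lemma card_cliques:
  assumes "\<And>x y. x \<in> set xs \<Longrightarrow> y \<in> set xs \<Longrightarrow> E x y \<Longrightarrow> E y x" "distinct xs"
  shows "card {C. C \<subseteq> set xs \<and> is_clique E n C} = length (cliques E n xs)"
proof -
  have "{C. C \<subseteq> set xs \<and> is_clique E n C} = set (map set (cliques E n xs))"
    using set_cliques[OF assms] by simp
  then show ?thesis using distinct_card[OF distinct_map_set_cliques[OF assms(2)]] by (metis length_map)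
qed

section \<open>The orthogonality graph\<close>

datatype z3 = Z0 | Z1 | Z2

fun zdiff :: "z3 \<Rightarrow> z3 \<Rightarrow> z3" where
  "zdiff x Z0 = x"
| "zdiff Z0 Z1 = Z2" | "zdiff Z1 Z1 = Z0" | "zdiff Z2 Z1 = Z1"
| "zdiff Z0 Z2 = Z1" | "zdiff Z1 Z2 = Z2" | "zdiff Z2 Z2 = Z0"

text \<open>
  The index \<open>((e\<^sub>0, e\<^sub>1, e\<^sub>2), (a\<^sub>0, a\<^sub>1, a\<^sub>2), n)\<close> stands for the solution in which \<open>g\<^sub>b\<close> is the cube root of
  unity with exponent \<open>e\<^sub>b\<close> and \<open>h\<^sub>b\<close> is \<open>1\<close>, \<open>\<kappa>\<close> or \<open>cnj \<kappa>\<close> according to \<open>a\<^sub>b\<close>, times the eighth root of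
  unity selected by \<open>n\<close>.
\<close>

type_synonym index = "(z3 \<times> z3 \<times> z3) \<times> (z3 \<times> z3 \<times> z3) \<times> bool"

text \<open>The families have 3 * 6 * 2 = 36 and 6 * 2 = 12 members. The first exponent is
  \<open>Z0\<close> because a global phase is free. In the first family the cyclic differences of
  the exponents coincide (parallel case); in the second they are the three distinct residues, so the
  corresponding cube roots sum to 0.\<close>

definition indices :: "index list" where
  "indices = List.product [(Z0,Z0,Z0), (Z0,Z1,Z2), (Z0,Z2,Z1)]
       (List.product [(Z0,Z1,Z2), (Z0,Z2,Z1), (Z1,Z0,Z2), (Z1,Z2,Z0), (Z2,Z0,Z1), (Z2,Z1,Z0)] [False, True])
     @ List.product [(Z0,Z0,Z1), (Z0,Z0,Z2), (Z0,Z1,Z0), (Z0,Z2,Z0), (Z0,Z1,Z1), (Z0,Z2,Z2)]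
       (List.product [(Z0,Z0,Z0)] [False, True])"

text \<open>
  A pair \<open>(x, y)\<close> encodes the real number \<open>x + y * Re \<kappa>\<close>. The tables give the real part, and the
  imaginary part divided by \<open>Im \<kappa>\<close>, of \<open>cnj \<kappa>\<^sub>a * \<kappa>\<^sub>b\<close> for \<open>\<kappa>\<^sub>a, \<kappa>\<^sub>b \<in> {1, \<kappa>, cnj \<kappa>}\<close>.
\<close>

fun re_coeff :: "z3 \<Rightarrow> z3 \<Rightarrow> int \<times> int" where
  "re_coeff Z0 Z0 = (1, 0)" | "re_coeff Z1 Z1 = (1, 0)" | "re_coeff Z2 Z2 = (1, 0)"
| "re_coeff Z1 Z2 = (0, -2)" | "re_coeff Z2 Z1 = (0, -2)"
| "re_coeff Z0 Z1 = (0, 1)" | "re_coeff Z0 Z2 = (0, 1)" | "re_coeff Z1 Z0 = (0, 1)" | "re_coeff Z2 Z0 = (0, 1)"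

fun im_coeff :: "z3 \<Rightarrow> z3 \<Rightarrow> int \<times> int" where
  "im_coeff Z0 Z0 = (0, 0)" | "im_coeff Z1 Z1 = (0, 0)" | "im_coeff Z2 Z2 = (0, 0)"
| "im_coeff Z1 Z2 = (0, -2)" | "im_coeff Z2 Z1 = (0, 2)"
| "im_coeff Z0 Z1 = (1, 0)" | "im_coeff Z0 Z2 = (-1, 0)" | "im_coeff Z1 Z0 = (-1, 0)" | "im_coeff Z2 Z0 = (1, 0)"

text \<open>The flag says whether the two eighth roots of unity agree. If they do, their phases
  cancel and real parts matter; if not, the quotient is \<open>\<i>\<close> up to sign, which turns
  real parts into imaginary parts.\<close>

fun coeff_of :: "bool \<Rightarrow> z3 \<Rightarrow> z3 \<Rightarrow> int \<times> int" where
  "coeff_of True a b = re_coeff a b"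
| "coeff_of False a b = im_coeff a b"

fun pair_add :: "int \<times> int \<Rightarrow> int \<times> int \<Rightarrow> int \<times> int" where
  "pair_add (a, b) (c, d) = (a + c, b + d)"

fun select_class :: "z3 \<Rightarrow> z3 \<Rightarrow> int \<times> int \<Rightarrow> int \<times> int" where
  "select_class r e v = (if e = r then v else (0, 0))"

fun class_sum :: "z3 \<Rightarrow> z3 \<Rightarrow> z3 \<Rightarrow> z3 \<Rightarrow> int \<times> int \<Rightarrow> int \<times> int \<Rightarrow> int \<times> int \<Rightarrow> int \<times> int" where
  "class_sum r e0 e1 e2 v0 v1 v2 = pair_add (select_class r e0 v0) (pair_add (select_class r e1 v1) (select_class r e2 v2))"

text \<open>Up to a factor, \<open>1 + omega3 + cnj omega3 = 0\<close> is the only real relation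
  between the cube roots of unity, so a combination vanishes exactly if the three collected
  coefficients agree.\<close>

fun vanish :: "z3 \<Rightarrow> z3 \<Rightarrow> z3 \<Rightarrow> int \<times> int \<Rightarrow> int \<times> int \<Rightarrow> int \<times> int \<Rightarrow> bool" where
  "vanish e0 e1 e2 v0 v1 v2 \<longleftrightarrow> class_sum Z0 e0 e1 e2 v0 v1 v2 = class_sum Z1 e0 e1 e2 v0 v1 v2
     \<and> class_sum Z0 e0 e1 e2 v0 v1 v2 = class_sum Z2 e0 e1 e2 v0 v1 v2"

fun adj :: "index \<Rightarrow> index \<Rightarrow> bool" where
  "adj ((e0, e1, e2), (a0, a1, a2), n) ((f0, f1, f2), (b0, b1, b2), m) \<longleftrightarrow>
     vanish (zdiff f0 e0) (zdiff f1 e1) (zdiff f2 e2)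
       (coeff_of (n = m) a0 b0) (coeff_of (n = m) a1 b1) (coeff_of (n = m) a2 b2)"

lemma length_cliques_indices: "length (cliques adj 6 indices) = 16"
  by code_simp

text \<open>This is the combinatorial form of maximality: each candidate vector is equal or
  orthogonal to a member of each basis.\<close>

lemma cliques_indices_dominating:
  "list_all (\<lambda>c. list_all (\<lambda>i. list_ex (\<lambda>j. i = j \<or> adj j i) c) indices) (cliques adj 6 indices)"
  by code_simp

text \<open>Equal vectors are orthogonal to the same vectors, so this separates the 48 vectors
  without comparing their entries.\<close>

lemma distinct_neighbourhoods: "distinct (map (\<lambda>i. filter (adj i) indices) indices)"
  by code_simp

section \<open>The equations for flat vectors\<close>

definition omega3 :: complex where
  "omega3 = Complex (-1/2) (sqrt 3 / 2)"

lemma omega3_square: "omega3 * omega3 = cnj omega3"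
  by (simp add: omega3_def complex_eq_iff)

lemma omega3_cube: "omega3 * cnj omega3 = 1"
  by (simp add: omega3_def complex_eq_iff)

lemma omega3_sum: "1 + omega3 + cnj omega3 = 0"
  by (simp add: omega3_def complex_eq_iff)

fun root3 :: "z3 \<Rightarrow> complex" where
  "root3 Z0 = 1" | "root3 Z1 = omega3" | "root3 Z2 = cnj omega3"

lemma cube_root_of_unity:
  assumes "z ^ 3 = (1::complex)"
  obtains e where "z = root3 e"
proof -
  have "(z - 1) * (z - omega3) * (z - cnj omega3) = z ^ 3 - 1"
    using omega3_sum omega3_cube by Groebner_Basis.algebra
  also have "z ^ 3 - 1 = 0" using assms by simp
  finally have "z = root3 Z0 \<or> z = root3 Z1 \<or> z = root3 Z2" by simp
  then show thesis using that by blast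
qed

lemma root3_unimodular: "root3 e * cnj (root3 e) = 1"
  by (cases e) (simp_all add: omega3_cube mult.commute)

text \<open>The numbers \<open>kappa_re\<close> and plus or minus \<open>kappa_im\<close> are the
  real and imaginary parts of the roots of \<open>K * K - 2 * kappa_re * K + 1\<close>, the
  quadratic factor of the cubic \<open>K ^ 3 - sqrt 3 * K ^ 2 + sqrt 3 * K - 1\<close>.\<close>

definition kappa_re :: real where "kappa_re = (sqrt 3 - 1) / 2"
definition kappa_im :: real where "kappa_im = sqrt (sqrt 3 / 2)"

lemma kappa_parts: "sqrt 3 = 1 + 2 * kappa_re" "kappa_re * kappa_re = 1/2 - kappa_re" "kappa_im * kappa_im = 1/2 + kappa_re" "0 < kappa_re" "kappa_re < 1" "0 < kappa_im"
proof -
  show 1: "sqrt 3 = 1 + 2 * kappa_re" by (simp add: kappa_re_def field_simps)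
  show 2: "kappa_re * kappa_re = 1/2 - kappa_re" by (simp add: kappa_re_def field_simps)
  show "kappa_im * kappa_im = 1/2 + kappa_re" by (simp add: kappa_im_def kappa_re_def field_simps)
  show 3: "0 < kappa_re" by (simp add: kappa_re_def)
  show "kappa_re < 1" using real_less_lsqrt[of 3 3] by (simp add: kappa_re_def)
  show "0 < kappa_im" by (simp add: kappa_im_def)
qed

fun kappa :: "z3 \<Rightarrow> complex" where
  "kappa Z0 = 1" | "kappa Z1 = Complex kappa_re kappa_im" | "kappa Z2 = Complex kappa_re (- kappa_im)"

lemma kappa_unimodular: "kappa a * cnj (kappa a) = 1"
  by (cases a) (simp_all add: complex_eq_iff kappa_parts)

fun eta :: "bool \<Rightarrow> complex" where
  "eta False = Complex (1 / sqrt 2) (1 / sqrt 2)"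
| "eta True = Complex (- 1 / sqrt 2) (1 / sqrt 2)"

lemma eta_unimodular: "eta n * cnj (eta n) = 1"
  by (cases n) (simp_all add: complex_eq_iff)

abbreviation perms3 :: "(z3 \<times> z3 \<times> z3) set" where
  "perms3 \<equiv> {(Z0,Z1,Z2), (Z0,Z2,Z1), (Z1,Z0,Z2), (Z1,Z2,Z0), (Z2,Z0,Z1), (Z2,Z1,Z0)}"

lemma reciprocal_sum:
  assumes "K * K - s * K + 1 = 0" "K * L = (1::complex)"
  shows "K + L = s"
  using assms by Groebner_Basis.algebra

lemma cubic_roots_case_plus:
  fixes K :: complex
  assumes K: "K * cnj K = 1" and eq: "K ^ 3 - sqrt 3 * K ^ 2 + sqrt 3 * K - 1 = 0"
  obtains a where "K = kappa a"
proof -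
  have "(K - 1) * (K * K - 2 * kappa_re * K + 1) = 0"
    using eq unfolding kappa_parts(1) by (simp add: eval_nat_numeral algebra_simps)
  then consider "K = 1" | "K * K - 2 * kappa_re * K + 1 = 0" by auto
  then show thesis
  proof cases
    case 1
    then show thesis using that[of Z0] by simp
  next
    case 2
    then have "K + cnj K = 2 * kappa_re" using K reciprocal_sum by blast
    then have re: "Re K = kappa_re" by (simp add: complex_eq_iff)
    have "Re K * Re K + Im K * Im K = 1" using K by (simp add: complex_eq_iff)
    then have "Im K * Im K = kappa_im * kappa_im" using re kappa_parts by simp
    then have "Im K = kappa_im \<or> Im K = - kappa_im" by (simp add: square_eq_iff)
    then show thesis using re that[of Z1] that[of Z2] by (auto simp: complex_eq_iff)
  qed
qed

text \<open>The other factor is \<open>K * K - (1 + sqrt 3) * K + 1\<close>; a unimodular root of it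
  would have real part \<open>(1 + sqrt 3) / 2\<close>, which exceeds 1.\<close>

lemma cubic_roots_case_minus:
  fixes K :: complex
  assumes K: "K * cnj K = 1" and eq: "K ^ 3 - sqrt 3 * K ^ 2 - sqrt 3 * K + 1 = 0"
  shows "K = - 1"
proof (rule ccontr)
  assume "K \<noteq> - 1"
  have "(K + 1) * (K * K - (1 + sqrt 3) * K + 1) = 0"
    using eq by (simp add: eval_nat_numeral algebra_simps)
  then have "K * K - (1 + sqrt 3) * K + 1 = 0" using \<open>K \<noteq> - 1\<close>
    unfolding mult_eq_0_iff by (metis eq_neg_iff_add_eq_0)
  then have "K + cnj K = 1 + sqrt 3" using K reciprocal_sum by blast
  then have "2 * Re K = 1 + sqrt 3" by (simp add: complex_eq_iff)
  moreover have "cmod K = 1" using K by (simp add: complex_mod_sqrt_Re_mult_cnj)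
  then have "Re K \<le> 1" using complex_Re_le_cmod[of K] by simp
  moreover have "sqrt 3 > 1" by simp
  ultimately show False by linarith
qed

text \<open>For unimodular numbers the second elementary symmetric function is the product
  \<open>E\<close> times the conjugate of the first. Hence it equals \<open>sqrt 3 * E\<close>, its
  reality forces \<open>E\<close> to be 1 or -1, and the three numbers are roots of an explicit
  cubic.\<close>

lemma kappa_triple:
  assumes K: "K0 * cnj K0 = 1" "K1 * cnj K1 = 1" "K2 * cnj K2 = 1"
    and sum: "K0 + K1 + K2 = sqrt 3" and im: "Im (K0 * K1 + K1 * K2 + K2 * K0) = 0"
  shows "\<exists>(a0, a1, a2) \<in> perms3. K0 = kappa a0 \<and> K1 = kappa a1 \<and> K2 = kappa a2"
proof -
  define E where "E = K0 * K1 * K2"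
  have csum: "cnj K0 + cnj K1 + cnj K2 = sqrt 3" using arg_cong[OF sum, of cnj] by simp
  have e2: "K0 * K1 + K1 * K2 + K2 * K0 = sqrt 3 * E"
  proof -
    have "K0 * K1 + K1 * K2 + K2 * K0 = (cnj K0 + cnj K1 + cnj K2) * E"
      using K unfolding E_def by Groebner_Basis.algebra
    then show ?thesis unfolding csum .
  qed
  have "Im E = 0" using im unfolding e2 by simp
  moreover have EE: "E * cnj E = 1" unfolding E_def complex_cnj_mult using K by Groebner_Basis.algebra
  ultimately have "Re E * Re E = 1" by (simp add: complex_eq_iff)
  then have "E = 1 \<or> E = - 1" using \<open>Im E = 0\<close> by (auto simp: complex_eq_iff square_eq_1_iff)
  moreover have eq: "K ^ 3 - sqrt 3 * K ^ 2 + sqrt 3 * E * K - E = 0" if "K \<in> {K0, K1, K2}" for K :: complex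
  proof -
    have "(K - K0) * (K - K1) * (K - K2) = 0" using that by auto
    then have "K ^ 3 - (K0 + K1 + K2) * K ^ 2 + (K0 * K1 + K1 * K2 + K2 * K0) * K - K0 * K1 * K2 = 0"
      by Groebner_Basis.algebra
    then show ?thesis unfolding sum e2 E_def .
  qed
  \<comment> \<open>For this sign the only unimodular root is -1, and three of them sum to
    -3.\<close>
  moreover have False if E: "E = - 1"
  proof -
    have "K = - 1" if "K \<in> {K0, K1, K2}" for K :: complex
      using that K eq[OF that] by (intro cubic_roots_case_minus) (auto simp: E)
    then have "K0 = - 1" "K1 = - 1" "K2 = - 1" by auto
    then have "sqrt 3 = - 3" using sum by (simp add: complex_eq_iff)
    moreover have "sqrt 3 > 0" by simp
    ultimately show False by linarith
  qed
  ultimately have E: "E = 1" by blast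
  have ex: "\<exists>a. K = kappa a" if "K \<in> {K0, K1, K2}" for K :: complex
  proof -
    have "K * cnj K = 1" using that K by auto
    moreover have "K ^ 3 - sqrt 3 * K ^ 2 + sqrt 3 * K - 1 = 0" using eq[OF that] by (simp add: E)
    ultimately show ?thesis by (metis cubic_roots_case_plus)
  qed
  obtain a0 a1 a2 where a: "K0 = kappa a0" "K1 = kappa a1" "K2 = kappa a2"
    using ex[of K0] ex[of K1] ex[of K2] insertI1 insertI2 by (metis (no_types))
  have "Re K0 + Re K1 + Re K2 = 1 + 2 * kappa_re" "Im K0 + Im K1 + Im K2 = 0"
    using sum by (simp_all add: complex_eq_iff kappa_parts)
  \<comment> \<open>Vanishing imaginary part means equally many \<open>Z1\<close> and
    \<open>Z2\<close>; the real part excludes three times \<open>Z0\<close>, since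
    \<open>kappa_re < 1\<close>.\<close>
  then have "(a0, a1, a2) \<in> perms3"
    unfolding a using kappa_parts(4-) by (cases a0; cases a1; cases a2) simp_all
  then show ?thesis using a by blast
qed

section \<open>Vectors of length six built from triples\<close>

text \<open>
  By the Chinese remainder theorem \<open>k mod 3\<close> and the parity of \<open>k\<close> are independent coordinates on the
  six positions.
\<close>

definition interleave :: "(nat \<Rightarrow> complex) \<Rightarrow> (nat \<Rightarrow> complex) \<Rightarrow> nat \<Rightarrow> complex" where
  "interleave g h k = g (k mod 3) * (if even k then h (k mod 3) else cnj (h (k mod 3)))"

definition balanced :: "(nat \<Rightarrow> complex) \<Rightarrow> (nat \<Rightarrow> complex) \<Rightarrow> bool" where
  "balanced g h \<longleftrightarrow> (Re (h 0))\<^sup>2 + (Re (h 1))\<^sup>2 + (Re (h 2))\<^sup>2 = 3 / 2 \<and>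
     g 0 * cnj (g 1) * (Re (h 0) * Re (h 1)) + g 1 * cnj (g 2) * (Re (h 1) * Re (h 2))
       + g 2 * cnj (g 0) * (Re (h 2) * Re (h 0)) = 0 \<and>
     g 0 * cnj (g 1) * (Im (h 0) * Im (h 1)) + g 1 * cnj (g 2) * (Im (h 1) * Im (h 2))
       + g 2 * cnj (g 0) * (Im (h 2) * Im (h 0)) = 0"

fun pick :: "'a \<times> 'a \<times> 'a \<Rightarrow> nat \<Rightarrow> 'a" where
  "pick (x, y, z) b = (if b = 0 then x else if b = 1 then y else z)"

definition gpart :: "index \<Rightarrow> nat \<Rightarrow> complex" where
  "gpart i b = root3 (pick (fst i) b)"

definition hpart :: "index \<Rightarrow> nat \<Rightarrow> complex" where
  "hpart i b = eta (snd (snd i)) * kappa (pick (fst (snd i)) b)"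

definition entry :: "index \<Rightarrow> nat \<Rightarrow> complex" where
  "entry i = interleave (gpart i) (hpart i)"

definition indexed :: "(nat \<Rightarrow> complex) \<Rightarrow> bool" where
  "indexed u \<longleftrightarrow> (\<exists>i \<in> set indices. \<exists>c. cmod c = 1 \<and> (\<forall>k<6. u k = c * entry i k))"

text \<open>A common sign \<open>t\<close> of all \<open>h b\<close> is a sign of the whole vector
  and goes into the phase; so two of the four primitive eighth roots of unity suffice for
  \<open>eta\<close>.\<close>

lemma indexedI:
  assumes "((e0, e1, e2), (a0, a1, a2), n) \<in> set indices" "cmod c = 1" "t = 1 \<or> t = - 1"
    and "g 0 = c * root3 e0" "g 1 = c * root3 e1" "g 2 = c * root3 e2"
    and "h 0 = t * eta n * kappa a0" "h 1 = t * eta n * kappa a1" "h 2 = t * eta n * kappa a2"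
  shows "indexed (interleave g h)"
  unfolding indexed_def
proof (intro bexI exI conjI allI impI)
  show "cmod (c * t) = 1" using assms by (auto simp: norm_mult)
  fix k :: nat assume "k < 6"
  have "k mod 3 \<in> {0, 1, 2}" by auto
  then show "interleave g h k = c * t * entry ((e0, e1, e2), (a0, a1, a2), n) k"
    using assms(3-) by (auto simp: entry_def interleave_def gpart_def hpart_def)
qed (rule assms(1))

lemma set_indices:
  "set indices = {(Z0,Z0,Z0), (Z0,Z1,Z2), (Z0,Z2,Z1)} \<times> perms3 \<times> UNIV
     \<union> {(Z0,Z0,Z1), (Z0,Z0,Z2), (Z0,Z1,Z0), (Z0,Z2,Z0), (Z0,Z1,Z1), (Z0,Z2,Z2)} \<times> {(Z0,Z0,Z0)} \<times> UNIV"
  unfolding indices_def set_append set_product UNIV_bool list.set ..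

text \<open>Conjugating the sum and using product 1 makes the second elementary symmetric function
  vanish too, so all three numbers are roots of \<open>z ^ 3 - 1\<close>.\<close>

lemma vanishing_triple:
  assumes "d0 * cnj d0 = 1" "d1 * cnj d1 = 1" "d2 * cnj d2 = 1"
    and "d0 * d1 * d2 = 1" "d0 + d1 + d2 = 0"
  obtains a0 a1 a2 where "d0 = root3 a0" "d1 = root3 a1" "d2 = root3 a2" "(a0, a1, a2) \<in> perms3"
proof -
  have "cnj d0 + cnj d1 + cnj d2 = 0" using arg_cong[OF assms(5), of cnj] by simp
  then have e2: "d0 * d1 + d1 * d2 + d2 * d0 = 0" using assms by Groebner_Basis.algebra
  have "d0 ^ 3 = 1" "d1 ^ 3 = 1" "d2 ^ 3 = 1"
    using e2 assms(4,5) by Groebner_Basis.algebra+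
  then obtain a0 a1 a2 where a: "d0 = root3 a0" "d1 = root3 a1" "d2 = root3 a2"
    by (metis cube_root_of_unity)
  have "Re d0 + Re d1 + Re d2 = 0" "Im d0 + Im d1 + Im d2 = 0" using assms(5) by (simp_all add: complex_eq_iff)
  then have "(a0, a1, a2) \<in> perms3" unfolding a
    by (cases a0; cases a1; cases a2) (simp_all add: omega3_def)
  then show thesis using a that by blast
qed

lemma eta_cases:
  assumes "C * C = 3 / 2" "S * S = 3 / (2::real)"
  obtains t n where "t = 1 \<or> t = - 1" "Complex C S = sqrt 3 * (t * eta n)"
proof -
  define r :: real where "r = sqrt 3 / sqrt 2"
  have r: "r * r = 3 / 2" by (simp add: r_def field_simps)
  then have "C = r \<or> C = - r" "S = r \<or> S = - r" using assms by (simp_all flip: square_eq_iff)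
  moreover have "Complex r r = sqrt 3 * (1 * eta False)" "Complex (- r) (- r) = sqrt 3 * (- 1 * eta False)"
    "Complex (- r) r = sqrt 3 * (1 * eta True)" "Complex r (- r) = sqrt 3 * (- 1 * eta True)"
    by (simp_all add: r_def complex_eq_iff)
  ultimately show thesis using that by metis
qed

section \<open>The parallel case\<close>

lemma eta_square: "Re (cnj (eta n) * cnj (eta n)) = 0"
  by (cases n) simp_all

text \<open>The common ratio \<open>d\<close> satisfies \<open>d ^ 3 = 1\<close> and cancels from
  the relations. Squaring the sums of real and of imaginary parts then gives 3/2 each, so
  \<open>h 0 + h 1 + h 2\<close> is \<open>sqrt 3\<close> times a primitive eighth root of unity.
  Rotating that root away by \<open>w\<close> leads to \<open>kappa_triple\<close>.\<close>

lemma balanced_parallel: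
  assumes g: "\<And>b. g b * cnj (g b) = 1" and h: "\<And>b. h b * cnj (h b) = 1" and bal: "balanced g h"
    and par: "g 0 * cnj (g 1) = g 1 * cnj (g 2)" "g 1 * cnj (g 2) = g 2 * cnj (g 0)"
  shows "indexed (interleave g h)"
proof -
  define d where "d = g 2 * cnj (g 0)"
  have d0: "g 0 * cnj (g 1) = d" and d1: "g 1 * cnj (g 2) = d" and d2: "g 2 * cnj (g 0) = d"
    using par by (simp_all add: d_def)
  have "d ^ 3 = (g 0 * cnj (g 1)) * (g 1 * cnj (g 2)) * (g 2 * cnj (g 0))"
    unfolding d0 d1 d2 by (simp add: power3_eq_cube)
  also have "\<dots> = (g 0 * cnj (g 0)) * (g 1 * cnj (g 1)) * (g 2 * cnj (g 2))"
    by (simp only: mult_ac)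
  also have "\<dots> = 1" by (simp add: g)
  finally have d3: "d ^ 3 = 1" .
  then obtain e where e: "d = root3 e" by (rule cube_root_of_unity)
  have dn: "d \<noteq> 0" using d3 by auto
  let ?s = "h 0 + h 1 + h 2"
  have hn: "(Re (h b))\<^sup>2 + (Im (h b))\<^sup>2 = 1" for b
    using h[of b] by (simp add: complex_eq_iff power2_eq_square)
  have "d * of_real (Re (h 0) * Re (h 1) + Re (h 1) * Re (h 2) + Re (h 2) * Re (h 0)) = 0"
    "d * of_real (Im (h 0) * Im (h 1) + Im (h 1) * Im (h 2) + Im (h 2) * Im (h 0)) = 0"
    using bal unfolding balanced_def d0 d1 d2 by (simp_all add: algebra_simps)
  then have cc: "Re (h 0) * Re (h 1) + Re (h 1) * Re (h 2) + Re (h 2) * Re (h 0) = 0"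
    and ss: "Im (h 0) * Im (h 1) + Im (h 1) * Im (h 2) + Im (h 2) * Im (h 0) = 0"
    using dn by (simp_all only: mult_eq_0_iff of_real_eq_0_iff simp_thms)
  have c2: "(Re (h 0))\<^sup>2 + (Re (h 1))\<^sup>2 + (Re (h 2))\<^sup>2 = 3 / 2"
    using bal by (simp add: balanced_def)
  then have s2: "(Im (h 0))\<^sup>2 + (Im (h 1))\<^sup>2 + (Im (h 2))\<^sup>2 = 3 / 2"
    using hn[of 0] hn[of 1] hn[of 2] by linarith
  have "Re ?s * Re ?s = 3 / 2" "Im ?s * Im ?s = 3 / 2"
    using c2 s2 cc ss by (simp_all add: power2_eq_square algebra_simps)
  then obtain t n where t: "t = 1 \<or> t = - 1" and s: "Complex (Re ?s) (Im ?s) = sqrt 3 * (t * eta n)"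
    by (rule eta_cases)
  have tt: "t * t = 1" "cnj t = t" using t by auto
  define w where "w = t * cnj (eta n)"
  have w: "t * eta n * w = 1" unfolding w_def using tt eta_unimodular[of n] by Groebner_Basis.algebra
  have ww: "w * cnj w = 1" unfolding w_def using tt eta_unimodular[of n] by (simp add: algebra_simps)
  have sw: "h 0 * w + h 1 * w + h 2 * w = sqrt 3"
  proof -
    have "h 0 * w + h 1 * w + h 2 * w = ?s * w" by (simp only: distrib_right)
    also have "?s = sqrt 3 * (t * eta n)" using s by (simp only: complex_surj)
    also have "sqrt 3 * (t * eta n) * w = sqrt 3" using w by (simp only: mult.assoc mult_1_right)
    finally show ?thesis .
  qed
  \<comment> \<open>\<open>w * w\<close> is purely imaginary, so the vanishing real part of the
    second symmetric function of the \<open>h b\<close> becomes a vanishing imaginary part after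
    rotation.\<close>
  have sq: "w * w = cnj (eta n) * cnj (eta n)" unfolding w_def using tt by Groebner_Basis.algebra
  have "Re (w * w) = 0" unfolding sq by (rule eta_square)
  moreover have "Re (h 0 * h 1 + h 1 * h 2 + h 2 * h 0) = 0" using cc ss by simp
  ultimately have "Im ((w * w) * (h 0 * h 1 + h 1 * h 2 + h 2 * h 0)) = 0" by (simp only: times_complex.sel)
  then have im: "Im (h 0 * w * (h 1 * w) + h 1 * w * (h 2 * w) + h 2 * w * (h 0 * w)) = 0"
    by (simp only: ring_distribs mult_ac)
  have uni: "h b * w * cnj (h b * w) = 1" for b
    unfolding complex_cnj_mult using h[of b] ww by Groebner_Basis.algebra
  obtain a0 a1 a2 where a: "(a0, a1, a2) \<in> perms3"
    "h 0 * w = kappa a0" "h 1 * w = kappa a1" "h 2 * w = kappa a2"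
    using kappa_triple[OF uni uni uni sw im] by blast
  have hb: "h b = t * eta n * (h b * w)" for b using w by (simp add: mult_ac)
  \<comment> \<open>Relative to \<open>g 0\<close>, the factors \<open>g 1\<close> and
    \<open>g 2\<close> are \<open>cnj d\<close> and \<open>d\<close>; so \<open>e'\<close> is the
    negative of \<open>e\<close> modulo 3.\<close>
  obtain e' where e': "root3 e' = cnj d" "(e', e) \<in> {(Z0,Z0), (Z1,Z2), (Z2,Z1)}"
    unfolding e using that[of Z0] that[of Z1] that[of Z2] by (cases e) auto
  have gg: "g 0 = g 0 * root3 Z0" "g 1 = g 0 * root3 e'" "g 2 = g 0 * root3 e"
  proof -
    have "g 0 * root3 e' = (g 0 * cnj (g 0)) * g 1"
      unfolding e'(1) d0[symmetric] by simp
    then show "g 1 = g 0 * root3 e'" using g[of 0] by simp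
    have "g 0 * root3 e = (g 0 * cnj (g 0)) * g 2"
      unfolding e[symmetric] d2[symmetric] by simp
    then show "g 2 = g 0 * root3 e" using g[of 0] by simp
  qed simp
  show ?thesis
  proof (rule indexedI)
    show "((Z0, e', e), (a0, a1, a2), n) \<in> set indices"
      unfolding set_indices using a(1) e'(2) by blast
    show "cmod (g 0) = 1" using g[of 0] by (simp add: complex_mod_sqrt_Re_mult_cnj)
    show "h 0 = t * eta n * kappa a0" "h 1 = t * eta n * kappa a1" "h 2 = t * eta n * kappa a2"
      using hb[of 0] hb[of 1] hb[of 2] unfolding a by auto
  qed (use t gg in auto)
qed

section \<open>The non-parallel case\<close>

lemma equal_up_to_sign_if_nonzero:
  fixes c0 c1 c2 s0 s1 s2 :: real
  assumes n: "c0\<^sup>2 + s0\<^sup>2 = 1" "c1\<^sup>2 + s1\<^sup>2 = 1" "c2\<^sup>2 + s2\<^sup>2 = 1" and sum: "c0\<^sup>2 + c1\<^sup>2 + c2\<^sup>2 = 3 / 2"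
    and x: "c1 * s1 * (c0 * s2 - c2 * s0) = 0" "c2 * s2 * (c1 * s0 - c0 * s1) = 0"
      "c0 * s0 * (c2 * s1 - c1 * s2) = 0" and nz: "c1 * s1 \<noteq> 0"
  shows "c0\<^sup>2 = 1 / 2 \<and> c1\<^sup>2 = 1 / 2 \<and> c2\<^sup>2 = 1 / 2 \<and> c1 * s0 = c0 * s1 \<and> c2 * s1 = c1 * s2 \<and> c0 * s2 = c2 * s0"
proof -
  \<comment> \<open>Parallel unit vectors \<open>(a, s)\<close> and \<open>(b, t)\<close> agree up
    to sign.\<close>
  have cross: "a\<^sup>2 = b\<^sup>2" if "a * t = b * s" "a\<^sup>2 + s\<^sup>2 = 1" "b\<^sup>2 + t\<^sup>2 = 1" for a b s t :: real
    using that by Groebner_Basis.algebra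
  have e: "c0 * s2 = c2 * s0" using x(1) nz by simp
  have c02: "c0\<^sup>2 = c2\<^sup>2" using cross[OF e n(1,3)] .
  \<comment> \<open>Otherwise \<open>c0\<^sup>2\<close> and \<open>c2\<^sup>2\<close> are both 0 or
    both 1, which would give \<open>c1\<^sup>2\<close> the value 3/2 or -1/2.\<close>
  have nz0: "c0 * s0 \<noteq> 0"
  proof
    assume "c0 * s0 = 0"
    then have "c0\<^sup>2 = 0 \<or> c0\<^sup>2 = 1" using n(1) by auto
    moreover have "c1\<^sup>2 \<ge> 0" "c1\<^sup>2 \<le> 1" using n(2) zero_le_power2[of s1] by (simp, linarith)
    ultimately show False using sum c02 by auto
  qed
  have f: "c2 * s1 = c1 * s2" using x(3) nz0 by simp
  have "c2\<^sup>2 = c1\<^sup>2" using cross[OF f n(3,2)] .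
  moreover have "c2 * s2 \<noteq> 0"
  proof
    assume "c2 * s2 = 0"
    then have "c2\<^sup>2 = 0 \<or> s2\<^sup>2 = 0" by auto
    moreover have "s2\<^sup>2 = s0\<^sup>2" using n c02 by simp
    ultimately show False using nz0 c02 by auto
  qed
  then have "c1 * s0 = c0 * s1" using x(2) by simp
  ultimately show ?thesis using e f c02 sum by simp
qed

text \<open>The hypotheses are invariant under cyclic shifts, so any nonzero \<open>c * s\<close>
  will do. If all three vanish, every squared cosine is 0 or 1 and the sum cannot be 3/2.\<close>

lemma equal_up_to_sign:
  fixes c0 c1 c2 s0 s1 s2 :: real
  assumes n: "c0\<^sup>2 + s0\<^sup>2 = 1" "c1\<^sup>2 + s1\<^sup>2 = 1" "c2\<^sup>2 + s2\<^sup>2 = 1" and sum: "c0\<^sup>2 + c1\<^sup>2 + c2\<^sup>2 = 3 / 2"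
    and x: "c1 * s1 * (c0 * s2 - c2 * s0) = 0" "c2 * s2 * (c1 * s0 - c0 * s1) = 0"
      "c0 * s0 * (c2 * s1 - c1 * s2) = 0"
  shows "c0\<^sup>2 = 1 / 2 \<and> c1\<^sup>2 = 1 / 2 \<and> c2\<^sup>2 = 1 / 2 \<and> c1 * s0 = c0 * s1 \<and> c2 * s1 = c1 * s2 \<and> c0 * s2 = c2 * s0"
proof -
  consider "c1 * s1 \<noteq> 0" | "c2 * s2 \<noteq> 0" | "c0 * s0 \<noteq> 0" | "c0 * s0 = 0 \<and> c1 * s1 = 0 \<and> c2 * s2 = 0" by blast
  then show ?thesis
  proof cases
    case 1
    then show ?thesis using equal_up_to_sign_if_nonzero[OF n sum x] by simp
  next
    case 2
    have "c1\<^sup>2 + c2\<^sup>2 + c0\<^sup>2 = 3 / 2" using sum by simp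
    from equal_up_to_sign_if_nonzero[OF n(2,3,1) this x(2,3,1) 2] show ?thesis by simp
  next
    case 3
    have "c2\<^sup>2 + c0\<^sup>2 + c1\<^sup>2 = 3 / 2" using sum by simp
    from equal_up_to_sign_if_nonzero[OF n(3,1,2) this x(3,1,2) 3] show ?thesis by simp
  next
    case 4
    then have "c0\<^sup>2 = 0 \<or> c0\<^sup>2 = 1" "c1\<^sup>2 = 0 \<or> c1\<^sup>2 = 1" "c2\<^sup>2 = 0 \<or> c2\<^sup>2 = 1" using n by auto
    then show ?thesis using sum by auto
  qed
qed

lemma real_relation:
  assumes "a * of_real x + b * of_real y = 0" "Im (a * cnj b) \<noteq> 0" "b * cnj b = 1"
  shows "x = 0 \<and> y = (0::real)"
proof -
  have "a * cnj b * of_real x + of_real y = cnj b * (a * of_real x + b * of_real y)"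
    using assms(3) by Groebner_Basis.algebra
  then have "a * cnj b * of_real x + of_real y = 0" using assms(1) by simp
  then have "Im (a * cnj b) * x = 0" "Re (a * cnj b) * x + y = 0"
    by (simp_all only: complex_eq_iff plus_complex.sel times_complex.sel zero_complex.sel
        Re_complex_of_real Im_complex_of_real mult_zero_right add_0_right diff_zero add_0_left)
  then show ?thesis using assms(2) by simp
qed

text \<open>If \<open>a\<close> and \<open>b\<close> are independent over the reals, the real
  relations between \<open>a\<close>, \<open>b\<close>, \<open>c\<close> form a space of dimension
  at most one; hence the cross product of two coefficient vectors vanishes.\<close>

lemma two_real_relations:
  fixes x y z x' y' z' :: real
  assumes "a * of_real x + b * of_real y + c * of_real z = 0" "a * of_real x' + b * of_real y' + c * of_real z' = 0"
    and "Im (a * cnj b) \<noteq> 0" "b * cnj b = 1"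
  shows "x * z' = z * x' \<and> y * z' = z * y' \<and> x * y' = y * x'"
proof -
  have "a * of_real (x * z' - z * x') + b * of_real (y * z' - z * y') = 0"
    unfolding of_real_diff of_real_mult using assms(1,2) by Groebner_Basis.algebra
  from real_relation[OF this assms(3,4)] have 1: "x * z' = z * x'" "y * z' = z * y'" by auto
  have "b * of_real (y * x' - x * y') = c * of_real (x * z' - z * x')"
    unfolding of_real_diff of_real_mult using assms(1,2) by Groebner_Basis.algebra
  then have "b * of_real (y * x' - x * y') = 0"
    using 1(1) by (simp only: diff_self of_real_0 mult_zero_right)
  moreover have "b \<noteq> 0" using assms(4) by auto
  ultimately have "y * x' - x * y' = 0" by (simp only: mult_eq_0_iff of_real_eq_0_iff simp_thms)
  then show ?thesis using 1 by simp
qed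

lemma interleave_cong_sign:
  assumes "\<And>b. s b * s b = 1" "\<And>b. cnj (s b) = s b" "\<And>b. b < 3 \<Longrightarrow> g' b = s b * g b" "\<And>b. b < 3 \<Longrightarrow> h b = s b * h' b"
  shows "interleave g' h' = interleave g h"
proof
  fix k :: nat
  have "k mod 3 < 3" by simp
  then show "interleave g' h' k = interleave g h k"
    using assms(1)[of "k mod 3"] by (simp add: interleave_def assms)
qed

lemma balanced_sign:
  assumes "\<And>b. s b = 1 \<or> s b = - 1"
  shows "balanced (\<lambda>b. s b * g b) (\<lambda>b. s b * h b) = balanced g h"
  using assms[of 0] assms[of 1] assms[of 2] unfolding balanced_def by (elim disjE) simp_all

lemma balanced_nonparallel:
  assumes g: "\<And>b. g b * cnj (g b) = 1" and h: "\<And>b. h b * cnj (h b) = 1" and bal: "balanced g h"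
    and npar: "Im (g 0 * cnj (g 1) * cnj (g 1 * cnj (g 2))) \<noteq> 0 \<or> Im (g 1 * cnj (g 2) * cnj (g 2 * cnj (g 0))) \<noteq> 0"
  shows "indexed (interleave g h)"
proof -
  define c where "c b = Re (h b)" for b
  define s where "s b = Im (h b)" for b
  have u: "g a * cnj (g b) * cnj (g a * cnj (g b)) = 1" for a b
    unfolding complex_cnj_mult complex_cnj_cnj using g[of a] g[of b] by Groebner_Basis.algebra
  have n: "(c b)\<^sup>2 + (s b)\<^sup>2 = 1" for b
    using h[of b] by (simp add: complex_eq_iff power2_eq_square c_def s_def)
  have C: "g 0 * cnj (g 1) * of_real (c 0 * c 1) + g 1 * cnj (g 2) * of_real (c 1 * c 2)
       + g 2 * cnj (g 0) * of_real (c 2 * c 0) = 0"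
    and S: "g 0 * cnj (g 1) * of_real (s 0 * s 1) + g 1 * cnj (g 2) * of_real (s 1 * s 2)
       + g 2 * cnj (g 0) * of_real (s 2 * s 0) = 0"
    and c2: "(c 0)\<^sup>2 + (c 1)\<^sup>2 + (c 2)\<^sup>2 = 3 / 2"
    using bal unfolding balanced_def c_def s_def by simp_all
  have "c 0 * c 1 * (s 2 * s 0) = c 2 * c 0 * (s 0 * s 1) \<and> c 1 * c 2 * (s 2 * s 0) = c 2 * c 0 * (s 1 * s 2)
     \<and> c 0 * c 1 * (s 1 * s 2) = c 1 * c 2 * (s 0 * s 1)"
    using npar
  proof
    assume "Im (g 0 * cnj (g 1) * cnj (g 1 * cnj (g 2))) \<noteq> 0"
    from two_real_relations[OF C S this u] show ?thesis by blast
  next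
    assume npar: "Im (g 1 * cnj (g 2) * cnj (g 2 * cnj (g 0))) \<noteq> 0"
    have "g 1 * cnj (g 2) * of_real (c 1 * c 2) + g 2 * cnj (g 0) * of_real (c 2 * c 0)
        + g 0 * cnj (g 1) * of_real (c 0 * c 1) = 0"
      "g 1 * cnj (g 2) * of_real (s 1 * s 2) + g 2 * cnj (g 0) * of_real (s 2 * s 0)
        + g 0 * cnj (g 1) * of_real (s 0 * s 1) = 0"
      using C S by (simp_all only: add_ac)
    from two_real_relations[OF this npar u] show ?thesis by metis
  qed
  \<comment> \<open>Each vanishing minor contains a common factor \<open>c b * s b\<close>.\<close>
  then have X: "c 1 * s 1 * (c 0 * s 2 - c 2 * s 0) = 0" "c 2 * s 2 * (c 1 * s 0 - c 0 * s 1) = 0"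
      "c 0 * s 0 * (c 2 * s 1 - c 1 * s 2) = 0"
    by Groebner_Basis.algebra+
  have eq: "(c 0)\<^sup>2 = 1 / 2" "(c 1)\<^sup>2 = 1 / 2" "(c 2)\<^sup>2 = 1 / 2" "c 1 * s 0 = c 0 * s 1" "c 0 * s 2 = c 2 * s 0"
    using equal_up_to_sign[OF n n n c2 X] by auto
  \<comment> \<open>As every \<open>c b\<close> squares to 1/2, \<open>2 * c b * c 0\<close> is the
    sign relating \<open>h b\<close> to \<open>h 0\<close>. The default index 0 makes
    \<open>t\<close> a sign for all \<open>b\<close>, as \<open>interleave_cong_sign\<close>
    demands.\<close>
  define t where "t b = 2 * c (if b < 3 then b else 0) * c 0" for b :: nat
  have tt: "t b * t b = 1" for b
  proof -
    have "(c (if b < 3 then b else 0))\<^sup>2 = 1 / 2" using eq(1-3) by (auto simp: numeral_3_eq_3 less_Suc_eq numeral_2_eq_2)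
    then show ?thesis using eq(1) unfolding t_def by Groebner_Basis.algebra
  qed
  have t_h: "h b = of_real (t b) * h 0" if "b < 3" for b
  proof -
    have "c b * s 0 = c 0 * s b" using that eq by (auto simp: numeral_3_eq_3 less_Suc_eq numeral_2_eq_2)
    then have "t b * c 0 = c b" "t b * s 0 = s b" using that eq(1) unfolding t_def if_P[OF that] by Groebner_Basis.algebra+
    then show ?thesis by (simp add: complex_eq_iff c_def s_def)
  qed
  define G where "G b = of_real (t b) * g b" for b
  have inter: "interleave G (\<lambda>_. h 0) = interleave g h"
  proof (rule interleave_cong_sign[where s = "\<lambda>b. of_real (t b)"])
    show "complex_of_real (t b) * complex_of_real (t b) = 1" for b
      using tt[of b] by (metis of_real_1 of_real_mult)
    show "G b = complex_of_real (t b) * g b" for b by (rule G_def)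
  qed (simp_all only: complex_cnj_complex_of_real, rule t_h)
  have GG: "G b * cnj (G b) = 1" for b
  proof -
    have "G b * cnj (G b) = of_real (t b * t b) * (g b * cnj (g b))" unfolding G_def by (simp add: mult_ac)
    then show ?thesis using g tt by simp
  qed
  have t012: "t 0 = 2 * c 0 * c 0" "t 1 = 2 * c 1 * c 0" "t 2 = 2 * c 2 * c 0" by (simp_all add: t_def)
  \<comment> \<open>Moving the signs into \<open>G\<close> turns the cosine relation into a
    vanishing sum of unimodular numbers.\<close>
  have "G 0 * cnj (G 1) + G 1 * cnj (G 2) + G 2 * cnj (G 0)
     = 4 * (c 0)\<^sup>2 * (g 0 * cnj (g 1) * of_real (c 0 * c 1) + g 1 * cnj (g 2) * of_real (c 1 * c 2)
       + g 2 * cnj (g 0) * of_real (c 2 * c 0))"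
    unfolding G_def t012 by (simp add: power2_eq_square algebra_simps)
  then have sum: "G 0 * cnj (G 1) + G 1 * cnj (G 2) + G 2 * cnj (G 0) = 0" unfolding C by simp
  have U: "G a * cnj (G b) * cnj (G a * cnj (G b)) = 1" for a b
    unfolding complex_cnj_mult complex_cnj_cnj using GG[of a] GG[of b] by Groebner_Basis.algebra
  have "G 0 * cnj (G 1) * (G 1 * cnj (G 2)) * (G 2 * cnj (G 0)) = 1"
    using GG[of 0] GG[of 1] GG[of 2] by Groebner_Basis.algebra
  from vanishing_triple[OF U U U this sum] obtain a0 a1 a2 where a: "G 0 * cnj (G 1) = root3 a0"
    "G 2 * cnj (G 0) = root3 a2" "(a0, a1, a2) \<in> perms3" by metis
  obtain a' where a': "root3 a' = cnj (root3 a0)" "(a', a0) \<in> {(Z0,Z0), (Z1,Z2), (Z2,Z1)}"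
    using that[of Z0] that[of Z1] that[of Z2] by (cases a0) auto
  have "sqrt 3 * x * (sqrt 3 * x) = 3 * x\<^sup>2" for x
    by (simp add: power_mult_distrib flip: power2_eq_square)
  then have "sqrt 3 * c 0 * (sqrt 3 * c 0) = 3 / 2" "sqrt 3 * s 0 * (sqrt 3 * s 0) = 3 / 2"
    using eq(1) n[of 0] by simp_all
  then obtain e n where e: "e = 1 \<or> e = - 1" and "Complex (sqrt 3 * c 0) (sqrt 3 * s 0) = sqrt 3 * (e * eta n)"
    by (rule eta_cases)
  moreover have "Complex (sqrt 3 * c 0) (sqrt 3 * s 0) = sqrt 3 * h 0"
    by (simp add: complex_eq_iff c_def s_def)
  ultimately have h0: "h 0 = e * eta n" by simp
  have "indexed (interleave G (\<lambda>_. h 0))"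
  proof (rule indexedI)
    show "((Z0, a', a2), (Z0, Z0, Z0), n) \<in> set indices"
      unfolding set_indices using a(3) a'(2) by auto
    show "cmod (G 0) = 1" using GG[of 0] by (simp add: complex_mod_sqrt_Re_mult_cnj)
    have "G 0 * root3 a' = (G 0 * cnj (G 0)) * G 1" unfolding a'(1) a(1)[symmetric] by simp
    then show "G 1 = G 0 * root3 a'" using GG by simp
    have "G 0 * root3 a2 = (G 0 * cnj (G 0)) * G 2" unfolding a(2)[symmetric] by simp
    then show "G 2 = G 0 * root3 a2" using GG by simp
  qed (use e h0 in auto)
  then show ?thesis by (simp add: inter)
qed

text \<open>If neither ratio of consecutive \<open>d\<^sub>b\<close> has an imaginary part, both
  ratios are signs, and sign changes in \<open>g\<close> and \<open>h\<close> reduce to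
  \<open>balanced_parallel\<close>.\<close>

lemma balanced_indexed:
  assumes g: "\<And>b. g b * cnj (g b) = 1" and h: "\<And>b. h b * cnj (h b) = 1" and bal: "balanced g h"
  shows "indexed (interleave g h)"
proof (cases "Im (g 0 * cnj (g 1) * cnj (g 1 * cnj (g 2))) \<noteq> 0 \<or> Im (g 1 * cnj (g 2) * cnj (g 2 * cnj (g 0))) \<noteq> 0")
  case True
  then show ?thesis using balanced_nonparallel[OF g h bal] by blast
next
  case False
  define p where "p = g 0 * cnj (g 1) * cnj (g 1 * cnj (g 2))"
  define q where "q = g 1 * cnj (g 2) * cnj (g 2 * cnj (g 0))"
  have pm: "z = 1 \<or> z = - 1" if "Im z = 0" "z * cnj z = 1" for z
  proof -
    have "Re z * Re z = 1" using that by (simp add: complex_eq_iff)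
    then show ?thesis using that(1) by (auto simp: complex_eq_iff square_eq_1_iff)
  qed
  have "p * cnj p = 1" "q * cnj q = 1"
    unfolding p_def q_def complex_cnj_mult complex_cnj_cnj
    using g[of 0] g[of 1] g[of 2] by Groebner_Basis.algebra+
  then have pq: "p = 1 \<or> p = - 1" "q = 1 \<or> q = - 1" using pm False unfolding p_def q_def by blast+
  \<comment> \<open>The products \<open>s 0 * s 1\<close>, \<open>s 1 * s 2\<close>,
    \<open>s 2 * s 0\<close> are \<open>q\<close>, \<open>p * q\<close>, \<open>p\<close>, exactly
    what equalizes the three numbers in view of \<open>P\<close> and \<open>Q\<close> below.\<close>
  define s where "s b = (if b = 0 then p else if b = 1 then p * q else 1)" for b :: nat
  have s: "s b = 1 \<or> s b = - 1" for b unfolding s_def using pq by auto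
  have inter: "interleave (\<lambda>b. s b * g b) (\<lambda>b. s b * h b) = interleave g h"
  proof (rule interleave_cong_sign[where s = s])
    show "s b * s b = 1" "cnj (s b) = s b" for b using s[of b] by auto
    then show "h b = s b * (s b * h b)" for b by (simp flip: mult.assoc)
  qed simp
  have uni: "s b * z * cnj (s b * z) = 1" if "z * cnj z = 1" for b z
    using s[of b] that by auto
  have P: "g 0 * cnj (g 1) = p * (g 1 * cnj (g 2))" and Q: "g 1 * cnj (g 2) = q * (g 2 * cnj (g 0))"
    unfolding p_def q_def complex_cnj_mult complex_cnj_cnj
    using g[of 0] g[of 1] g[of 2] by Groebner_Basis.algebra+
  have "indexed (interleave (\<lambda>b. s b * g b) (\<lambda>b. s b * h b))"
  proof (rule balanced_parallel)
    show "balanced (\<lambda>b. s b * g b) (\<lambda>b. s b * h b)" using balanced_sign[OF s] bal by simp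
    have c: "cnj (s b * z) = s b * cnj z" for b z using s[of b] by auto
    have s012: "s 0 = p" "s 1 = p * q" "s 2 = 1" by (simp_all add: s_def)
    have p2: "p * p = 1" "q * q = 1" using pq by auto
    show "s 0 * g 0 * cnj (s 1 * g 1) = s 1 * g 1 * cnj (s 2 * g 2)"
      unfolding c unfolding s012 using P p2 by Groebner_Basis.algebra
    show "s 1 * g 1 * cnj (s 2 * g 2) = s 2 * g 2 * cnj (s 0 * g 0)"
      unfolding c unfolding s012 using Q p2 by Groebner_Basis.algebra
  qed (use uni g h in blast)+
  then show ?thesis by (simp add: inter)
qed

section \<open>Flatness of the Fourier transform\<close>

lemma cmod_three_term:
  assumes e: "e * e = cnj e" "e * cnj e = 1"
  shows "(cmod (x0 + e * x1 + cnj e * x2))\<^sup>2 = (cmod x0)\<^sup>2 + (cmod x1)\<^sup>2 + (cmod x2)\<^sup>2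
    + 2 * Re (cnj e * (x0 * cnj x1 + x1 * cnj x2 + x2 * cnj x0))"
proof -
  have ee: "cnj e * cnj e = e" using arg_cong[OF e(1), of cnj] by simp
  have product: "(x0 + e * x1 + f * x2) * (y0 + f * y1 + e * y2) = x0 * y0 + x1 * y1 + x2 * y2
      + (f * (x0 * y1 + x1 * y2 + x2 * y0) + e * (y0 * x1 + y1 * x2 + y2 * x0))"
    if "e * e = f" "e * f = 1" "f * f = e" for f y0 y1 y2
  proof -
    have "(x0 + e * x1 + f * x2) * (y0 + f * y1 + e * y2) = x0 * y0 + (e * f) * (x1 * y1 + x2 * y2)
      + (f * (x0 * y1 + x2 * y0) + (e * e) * (x1 * y2) + (e * (y0 * x1 + y2 * x0) + (f * f) * (y1 * x2)))"
      by (simp add: algebra_simps)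
    then show ?thesis unfolding that by (simp add: algebra_simps)
  qed
  let ?A = "x0 * cnj x1 + x1 * cnj x2 + x2 * cnj x0"
  have "complex_of_real ((cmod (x0 + e * x1 + cnj e * x2))\<^sup>2)
      = (x0 + e * x1 + cnj e * x2) * (cnj x0 + cnj e * cnj x1 + e * cnj x2)"
    unfolding complex_norm_square by simp
  also have "\<dots> = x0 * cnj x0 + x1 * cnj x1 + x2 * cnj x2
      + (cnj e * (x0 * cnj x1 + x1 * cnj x2 + x2 * cnj x0) + e * (cnj x0 * x1 + cnj x1 * x2 + cnj x2 * x0))"
    by (rule product[OF e ee])
  also have "e * (cnj x0 * x1 + cnj x1 * x2 + cnj x2 * x0) = cnj (cnj e * ?A)" by simp
  also have "cnj e * ?A + cnj (cnj e * ?A) = complex_of_real (2 * Re (cnj e * ?A))"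
    by (rule complex_add_cnj)
  finally have "complex_of_real ((cmod (x0 + e * x1 + cnj e * x2))\<^sup>2)
    = complex_of_real ((cmod x0)\<^sup>2 + (cmod x1)\<^sup>2 + (cmod x2)\<^sup>2 + 2 * Re (cnj e * ?A))"
    by (simp only: complex_norm_square[symmetric] of_real_add)
  then show ?thesis by (simp only: of_real_eq_iff)
qed

text \<open>Each squared modulus is the energy \<open>S\<close> plus twice the real part of the
  cyclic autocorrelation \<open>A\<close>, rotated by a cube root of unity. The three real parts sum
  to 0 and determine \<open>A\<close>, so all values equal \<open>N\<close> exactly if
  \<open>S = N\<close> and \<open>A = 0\<close>.\<close>

lemma three_term_flat:
  "(cmod (x0 + x1 + x2))\<^sup>2 = N \<and> (cmod (x0 + omega3 * x1 + cnj omega3 * x2))\<^sup>2 = N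
     \<and> (cmod (x0 + cnj omega3 * x1 + omega3 * x2))\<^sup>2 = N \<longleftrightarrow>
   (cmod x0)\<^sup>2 + (cmod x1)\<^sup>2 + (cmod x2)\<^sup>2 = N \<and> x0 * cnj x1 + x1 * cnj x2 + x2 * cnj x0 = 0"
proof -
  define A where "A = x0 * cnj x1 + x1 * cnj x2 + x2 * cnj x0"
  define S where "S = (cmod x0)\<^sup>2 + (cmod x1)\<^sup>2 + (cmod x2)\<^sup>2"
  have w: "cnj omega3 * cnj omega3 = omega3" using arg_cong[OF omega3_square, of cnj] by simp
  have 1: "(cmod (x0 + x1 + x2))\<^sup>2 = S + 2 * Re A"
    using cmod_three_term[of 1 x0 x1 x2] by (simp add: A_def S_def)
  have 2: "(cmod (x0 + omega3 * x1 + cnj omega3 * x2))\<^sup>2 = S + 2 * Re (cnj omega3 * A)"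
    unfolding A_def S_def by (rule cmod_three_term[OF omega3_square omega3_cube])
  have 3: "(cmod (x0 + cnj omega3 * x1 + omega3 * x2))\<^sup>2 = S + 2 * Re (omega3 * A)"
    using cmod_three_term[of "cnj omega3" x0 x1 x2] w omega3_cube by (simp add: A_def S_def mult.commute)
  define T where "T = sqrt 3 / 2 * Im A"
  have T: "T = 0 \<longleftrightarrow> Im A = 0" by (simp add: T_def)
  have "Re (cnj omega3 * A) = - Re A / 2 + T" "Re (omega3 * A) = - Re A / 2 - T"
    by (simp_all add: omega3_def T_def)
  then have "S + 2 * Re A = N \<and> S + 2 * Re (cnj omega3 * A) = N \<and> S + 2 * Re (omega3 * A) = N
    \<longleftrightarrow> S = N \<and> Re A = 0 \<and> T = 0" by auto
  then show ?thesis unfolding 1 2 3 A_def[symmetric] S_def[symmetric] T complex_eq_iff[of A] by simp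
qed

definition fourier_coeff :: "(nat \<Rightarrow> complex) \<Rightarrow> nat \<Rightarrow> complex" where
  "fourier_coeff u j = (\<Sum>k<6. cnj (omega6 ^ (j * k)) * u k)"

lemma cnj_omega6_power:
  "cnj (omega6 ^ m) = [1, - omega3, cnj omega3, - 1, omega3, - cnj omega3] ! (m mod 6)"
proof -
  have "omega6 ^ r = cnj ([1, - omega3, cnj omega3, - 1, omega3, - cnj omega3] ! r)" if "r < 6" for r
    using less_six_cases[OF that]
    by (elim insertE emptyE) (simp_all add: omega6_powers, simp_all add: omega6_eq omega3_def complex_eq_iff)
  from this[of "m mod 6"] show ?thesis by (subst omega6_mod) simp
qed

text \<open>Positions \<open>k\<close> and \<open>k + 3\<close> share \<open>g\<close> and carry
  conjugate values of \<open>h\<close>, while their characters differ by the factor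
  \<open>(-1) ^ j\<close>. So even frequencies see only real parts of \<open>h\<close>, odd ones
  only imaginary parts.\<close>

lemma fourier_coeff_interleave:
  fixes g h :: "nat \<Rightarrow> complex"
  defines "x \<equiv> \<lambda>b. g b * Re (h b)" and "y \<equiv> \<lambda>b. g b * Im (h b)"
  shows "fourier_coeff (interleave g h) 0 = 2 * (x 0 + x 1 + x 2)"
    and "fourier_coeff (interleave g h) 2 = 2 * (x 0 + cnj omega3 * x 1 + omega3 * x 2)"
    and "fourier_coeff (interleave g h) 4 = 2 * (x 0 + omega3 * x 1 + cnj omega3 * x 2)"
    and "fourier_coeff (interleave g h) 3 = 2 * \<i> * (y 0 + y 1 + y 2)"
    and "fourier_coeff (interleave g h) 1 = 2 * \<i> * (y 0 + omega3 * y 1 + cnj omega3 * y 2)"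
    and "fourier_coeff (interleave g h) 5 = 2 * \<i> * (y 0 + cnj omega3 * y 1 + omega3 * y 2)"
proof -
  have gh: "g b * h b = x b + \<i> * y b" "g b * cnj (h b) = x b - \<i> * y b" for b
    by (simp_all add: x_def y_def complex_eq_iff algebra_simps)
  have l: "{..<6} = {0, 1, 2, 3, 4, 5::nat}" by auto
  have u: "interleave g h 0 = x 0 + \<i> * y 0" "interleave g h 1 = x 1 - \<i> * y 1"
     "interleave g h 2 = x 2 + \<i> * y 2" "interleave g h 3 = x 0 - \<i> * y 0"
     "interleave g h 4 = x 1 + \<i> * y 1" "interleave g h 5 = x 2 - \<i> * y 2"
    using gh by (simp_all add: interleave_def)
  have F: "fourier_coeff (interleave g h) j =
      cnj (omega6 ^ (j * 0)) * (x 0 + \<i> * y 0) + cnj (omega6 ^ (j * 1)) * (x 1 - \<i> * y 1)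
    + cnj (omega6 ^ (j * 2)) * (x 2 + \<i> * y 2) + cnj (omega6 ^ (j * 3)) * (x 0 - \<i> * y 0)
    + cnj (omega6 ^ (j * 4)) * (x 1 + \<i> * y 1) + cnj (omega6 ^ (j * 5)) * (x 2 - \<i> * y 2)" for j
    unfolding fourier_coeff_def l u[symmetric] by simp
  show "fourier_coeff (interleave g h) 0 = 2 * (x 0 + x 1 + x 2)"
    and "fourier_coeff (interleave g h) 2 = 2 * (x 0 + cnj omega3 * x 1 + omega3 * x 2)"
    and "fourier_coeff (interleave g h) 4 = 2 * (x 0 + omega3 * x 1 + cnj omega3 * x 2)"
    and "fourier_coeff (interleave g h) 3 = 2 * \<i> * (y 0 + y 1 + y 2)"
    and "fourier_coeff (interleave g h) 1 = 2 * \<i> * (y 0 + omega3 * y 1 + cnj omega3 * y 2)"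
    and "fourier_coeff (interleave g h) 5 = 2 * \<i> * (y 0 + cnj omega3 * y 1 + omega3 * y 2)"
    unfolding F cnj_omega6_power by (simp_all add: algebra_simps)
qed

lemma flat_iff_balanced:
  assumes g: "\<And>b. g b * cnj (g b) = 1" and h: "\<And>b. h b * cnj (h b) = 1"
  shows "(\<forall>j<6. (cmod (fourier_coeff (interleave g h) j))\<^sup>2 = 6) \<longleftrightarrow> balanced g h"
proof -
  have six: "(\<forall>j<6. P j) \<longleftrightarrow> P 0 \<and> P 1 \<and> P 2 \<and> P 3 \<and> P 4 \<and> P (5::nat)" for P
    using less_six_cases by auto
  have c1: "(cmod (2 * z))\<^sup>2 = 6 \<longleftrightarrow> (cmod z)\<^sup>2 = 3 / 2" "(cmod (2 * \<i> * z))\<^sup>2 = 6 \<longleftrightarrow> (cmod z)\<^sup>2 = 3 / 2" for z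
    by (auto simp: norm_mult power_mult_distrib)
  have gn: "cmod (g b) = 1" for b using g[of b] by (simp add: complex_mod_sqrt_Re_mult_cnj)
  have n: "(cmod (g b * complex_of_real r))\<^sup>2 = r\<^sup>2" for b r by (simp add: norm_mult gn)
  have hn: "(Re (h b))\<^sup>2 + (Im (h b))\<^sup>2 = 1" for b
    using h[of b] by (simp add: complex_eq_iff power2_eq_square)
  \<comment> \<open>As each \<open>h b\<close> is unimodular, the two energy conditions are
    equivalent; \<open>balanced\<close> therefore states one of them.\<close>
  have s: "(Im (h 0))\<^sup>2 + (Im (h 1))\<^sup>2 + (Im (h 2))\<^sup>2 = 3 / 2 \<longleftrightarrow>
      (Re (h 0))\<^sup>2 + (Re (h 1))\<^sup>2 + (Re (h 2))\<^sup>2 = 3 / 2"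
    using hn[of 0] hn[of 1] hn[of 2] by linarith
  have pr: "g a * complex_of_real r * cnj (g b * complex_of_real t) = g a * cnj (g b) * (r * t)" for a b r t
    by simp
  show ?thesis
    unfolding six fourier_coeff_interleave c1 balanced_def
    using three_term_flat[of "g 0 * Re (h 0)" "g 1 * Re (h 1)" "g 2 * Re (h 2)" "3 / 2"]
      three_term_flat[of "g 0 * Im (h 0)" "g 1 * Im (h 1)" "g 2 * Im (h 2)" "3 / 2"]
    unfolding n pr s by blast
qed

section \<open>Orthogonality\<close>

text \<open>In \<open>3 * n\<^sup>2 = m\<^sup>2\<close> the prime 3 would occur with odd
  multiplicity on the left and even multiplicity on the right.\<close>

lemma sqrt_3_irrational:
  assumes "(sqrt 3 * of_int n :: real) = of_int m"
  shows "n = 0"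
proof (rule ccontr)
  assume "n \<noteq> 0"
  have "(of_int (3 * n\<^sup>2) :: real) = of_int (m\<^sup>2)"
    using assms[symmetric] by (simp add: power_mult_distrib)
  then have "3 * n\<^sup>2 = m\<^sup>2" by (simp only: of_int_eq_iff)
  then have "multiplicity 3 (3 * n\<^sup>2) = multiplicity 3 (m\<^sup>2)" by simp
  moreover have "m \<noteq> 0" using \<open>3 * n\<^sup>2 = m\<^sup>2\<close> \<open>n \<noteq> 0\<close> by auto
  moreover have p: "prime_elem (3::int)" by (simp add: prime_elem_iff_prime_abs)
  ultimately have "1 + 2 * multiplicity 3 n = 2 * multiplicity 3 m"
    using \<open>n \<noteq> 0\<close> by (simp add: prime_elem_multiplicity_mult_distrib prime_elem_multiplicity_power_distrib)
  then show False by presburger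
qed

fun surd :: "int \<times> int \<Rightarrow> real" where
  "surd (x, y) = of_int x + of_int y * kappa_re"

lemma surd_eq_iff: "surd v = surd w \<longleftrightarrow> v = w"
proof
  obtain x y x' y' where v: "v = (x, y)" "w = (x', y')" by (cases v, cases w) auto
  assume "surd v = surd w"
  then have "2 * of_int x + of_int y * (sqrt 3 - 1) = 2 * of_int x' + of_int y' * (sqrt 3 - 1)"
    unfolding v kappa_parts(1) by simp
  then have "sqrt 3 * of_int (y - y') = of_int (2 * (x' - x) + (y - y'))"
    by (simp add: algebra_simps)
  then have "y - y' = 0" by (rule sqrt_3_irrational)
  then show "v = w" using \<open>surd v = surd w\<close> by (simp add: v)
qed simp

lemma surd_pair_add: "surd (pair_add v w) = surd v + surd w"
  by (cases v; cases w) (simp add: algebra_simps)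

lemma omega3_combination_eq_0:
  "of_real A + omega3 * of_real B + cnj omega3 * of_real C = 0 \<longleftrightarrow> A = B \<and> A = C"
proof -
  have "of_real A + omega3 * of_real B + cnj omega3 * of_real C = 0 \<longleftrightarrow>
      A - B / 2 - C / 2 = 0 \<and> sqrt 3 / 2 * (B - C) = 0"
    by (simp add: complex_eq_iff omega3_def algebra_simps)
  also have "\<dots> \<longleftrightarrow> A - B / 2 - C / 2 = 0 \<and> B - C = 0" by simp
  also have "\<dots> \<longleftrightarrow> A = B \<and> A = C" by auto
  finally show ?thesis .
qed

lemma vanish_iff:
  "root3 e0 * of_real (surd v0) + root3 e1 * of_real (surd v1) + root3 e2 * of_real (surd v2) = 0
    \<longleftrightarrow> vanish e0 e1 e2 v0 v1 v2"
proof -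
  have r: "root3 e * of_real (surd v)
      = of_real (surd (select_class Z0 e v)) + omega3 * of_real (surd (select_class Z1 e v)) + cnj omega3 * of_real (surd (select_class Z2 e v))"
    for e v by (cases e) simp_all
  have "root3 e0 * of_real (surd v0) + root3 e1 * of_real (surd v1) + root3 e2 * of_real (surd v2)
    = of_real (surd (class_sum Z0 e0 e1 e2 v0 v1 v2)) + omega3 * of_real (surd (class_sum Z1 e0 e1 e2 v0 v1 v2))
      + cnj omega3 * of_real (surd (class_sum Z2 e0 e1 e2 v0 v1 v2))"
    unfolding r class_sum.simps surd_pair_add by (simp add: algebra_simps del: select_class.simps surd.simps)
  then show ?thesis by (simp only: omega3_combination_eq_0 surd_eq_iff vanish.simps)
qed

lemma cnj_root3_mult: "cnj (root3 e) * root3 f = root3 (zdiff f e)"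
proof -
  have "cnj omega3 * cnj omega3 = omega3" using arg_cong[OF omega3_square, of cnj] by simp
  then show ?thesis using omega3_square omega3_cube by (cases e; cases f) (simp_all add: mult.commute)
qed

lemma Re_cnj_kappa_mult: "Re (cnj (kappa a) * kappa b) = surd (re_coeff a b)"
  by (cases a; cases b) (simp_all add: kappa_parts algebra_simps)

lemma Im_cnj_kappa_mult: "Im (cnj (kappa a) * kappa b) = kappa_im * surd (im_coeff a b)"
  by (cases a; cases b) (simp_all add: algebra_simps)

lemma cnj_eta_mult: "cnj (eta n) * eta m = (if n = m then 1 else if n then - \<i> else \<i>)"
  by (cases n; cases m) (simp_all add: complex_eq_iff)

text \<open>The nonzero factor \<open>s\<close> depends only on \<open>n\<close> and
  \<open>m\<close>; it is common to all three residue classes and drops out of the orthogonality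
  test.\<close>

lemma Re_cnj_eta_kappa:
  obtains s where "s \<noteq> 0"
    "\<And>a b. Re (cnj (eta n * kappa a) * (eta m * kappa b)) = s * surd (coeff_of (n = m) a b)"
proof
  let ?s = "if n = m then 1 else if n then kappa_im else - kappa_im"
  show "?s \<noteq> 0" using kappa_parts(6) by auto
  fix a b
  have eq: "cnj (eta n * kappa a) * (eta m * kappa b) = (cnj (eta n) * eta m) * (cnj (kappa a) * kappa b)"
    by simp
  have re: "Re ((if n = m then 1 else if n then - \<i> else \<i>) * x) = (if n = m then Re x else if n then Im x else - Im x)" for x
    by simp
  show "Re (cnj (eta n * kappa a) * (eta m * kappa b)) = ?s * surd (coeff_of (n = m) a b)"
    unfolding eq cnj_eta_mult re Re_cnj_kappa_mult Im_cnj_kappa_mult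
    by (cases "n = m") (simp_all del: surd.simps)
qed

lemma gpart_unimodular: "gpart i b * cnj (gpart i b) = 1"
  by (simp add: gpart_def root3_unimodular)

lemma hpart_unimodular: "hpart i b * cnj (hpart i b) = 1"
proof -
  have "hpart i b * cnj (hpart i b) = (eta (snd (snd i)) * cnj (eta (snd (snd i)))) *
      (kappa (pick (fst (snd i)) b) * cnj (kappa (pick (fst (snd i)) b)))"
    by (simp add: hpart_def mult_ac)
  then show ?thesis by (simp only: eta_unimodular kappa_unimodular mult_1)
qed

lemma entry_unimodular: "cmod (entry i k) = 1"
proof -
  have "cmod (gpart i b) = 1" "cmod (hpart i b) = 1" for b
    using gpart_unimodular[of i b] hpart_unimodular[of i b] by (simp_all add: complex_mod_sqrt_Re_mult_cnj)
  then show ?thesis by (simp add: entry_def interleave_def norm_mult)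
qed

text \<open>Pairing the two positions in each residue class modulo 3 adds a number to its conjugate;
  what remains is a combination of cube roots of unity with surd coefficients, as in
  \<open>vanish_iff\<close>.\<close>

lemma sum_entry_eq_0_iff: "(\<Sum>k<6. cnj (entry i k) * entry j k) = 0 \<longleftrightarrow> adj i j"
proof -
  obtain e0 e1 e2 a0 a1 a2 n where i: "i = ((e0, e1, e2), (a0, a1, a2), n)" by (cases i) auto
  obtain f0 f1 f2 b0 b1 b2 m where j: "j = ((f0, f1, f2), (b0, b1, b2), m)" by (cases j) auto
  obtain s where s: "s \<noteq> 0"
    "\<And>a b. Re (cnj (eta n * kappa a) * (eta m * kappa b)) = s * surd (coeff_of (n = m) a b)"
    using Re_cnj_eta_kappa[of n m] by blast
  have z: "z + cnj z = of_real (2 * Re z)" for z by (rule complex_add_cnj)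
  have t: "cnj (p * x) * (q * y) + cnj (p * cnj x) * (q * cnj y) = cnj p * q * of_real (2 * Re (cnj x * y))"
    for p q x y
    unfolding z[symmetric] by (simp add: algebra_simps)
  have l: "{..<6} = {0, 1, 2, 3, 4, 5::nat}" by auto
  have "(\<Sum>k<6. cnj (entry i k) * entry j k) = (\<Sum>b\<in>{0, 1, 2}.
      cnj (gpart i b * hpart i b) * (gpart j b * hpart j b)
      + cnj (gpart i b * cnj (hpart i b)) * (gpart j b * cnj (hpart j b)))"
    unfolding l by (simp add: entry_def interleave_def)
  also have "\<dots> = (\<Sum>b\<in>{0, 1, 2}. cnj (gpart i b) * gpart j b * of_real (2 * Re (cnj (hpart i b) * hpart j b)))"
    by (simp only: t)
  also have "\<dots> = 2 * s * (root3 (zdiff f0 e0) * of_real (surd (coeff_of (n = m) a0 b0))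
      + root3 (zdiff f1 e1) * of_real (surd (coeff_of (n = m) a1 b1))
      + root3 (zdiff f2 e2) * of_real (surd (coeff_of (n = m) a2 b2)))"
    unfolding i j gpart_def hpart_def cnj_root3_mult fst_conv snd_conv s(2)
    by (simp add: algebra_simps del: surd.simps)
  finally show ?thesis using s(1) unfolding i j adj.simps vanish_iff[symmetric] by simp
qed

lemma sum_entry_self: "(\<Sum>k<6. cnj (entry i k) * entry i k) = 6"
proof -
  have "cnj (entry i k) * entry i k = 1" for k
    using entry_unimodular[of i k] by (metis complex_norm_square mult.commute of_real_1 power_one)
  then show ?thesis by simp
qed

text \<open>Multiplication by \<open>eta n\<close> replaces the coordinates of
  \<open>kappa a\<close> by their difference \<open>u\<close> and sum \<open>v\<close>, up to sign,
  order and the factor \<open>1 / sqrt 2\<close>.\<close>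

lemma eta_kappa_perm:
  fixes n a0 a1 a2
  defines "h0 \<equiv> eta n * kappa a0" and "h1 \<equiv> eta n * kappa a1" and "h2 \<equiv> eta n * kappa a2"
  assumes "(a0, a1, a2) \<in> perms3"
  shows "(Re h0)\<^sup>2 + (Re h1)\<^sup>2 + (Re h2)\<^sup>2 = 3 / 2"
    "Re h0 * Re h1 + Re h1 * Re h2 + Re h2 * Re h0 = 0"
    "Im h0 * Im h1 + Im h1 * Im h2 + Im h2 * Im h0 = 0"
proof -
  define u where "u a = Re (kappa a) - Im (kappa a)" for a
  define v where "v a = Re (kappa a) + Im (kappa a)" for a
  have q: "u Z0 = 1" "u Z1 = kappa_re - kappa_im" "u Z2 = kappa_re + kappa_im" "v Z0 = 1" "v Z1 = kappa_re + kappa_im" "v Z2 = kappa_re - kappa_im"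
    by (simp_all add: u_def v_def)
  have sq: "(kappa_re - kappa_im) * (kappa_re - kappa_im) = 1 - 2 * kappa_re * kappa_im" "(kappa_re + kappa_im) * (kappa_re + kappa_im) = 1 + 2 * kappa_re * kappa_im"
    "(kappa_re - kappa_im) * (kappa_re + kappa_im) = - 2 * kappa_re" "(kappa_re + kappa_im) * (kappa_re - kappa_im) = - 2 * kappa_re"
    using kappa_parts(2,3) by (simp_all add: algebra_simps)
  have uv: "u a0 * u a0 + u a1 * u a1 + u a2 * u a2 = 3" "v a0 * v a0 + v a1 * v a1 + v a2 * v a2 = 3"
    "u a0 * u a1 + u a1 * u a2 + u a2 * u a0 = 0" "v a0 * v a1 + v a1 * v a2 + v a2 * v a0 = 0"
    using assms(4) by (auto simp: q sq)
  define r where "r = 1 / sqrt 2"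
  have r: "r * r = 1 / 2" by (simp add: r_def)
  obtain p p' where p: "\<And>a. Re (eta n * kappa a) = r * p a" "\<And>a. Im (eta n * kappa a) = r * p' a"
    "p = u \<and> p' = v \<or> p = (\<lambda>a. - v a) \<and> p' = u"
  proof (cases n)
    case True
    show thesis by (rule that[of "\<lambda>a. - v a" u]) (simp_all add: True r_def u_def v_def diff_divide_distrib add_divide_distrib)
  next
    case False
    show thesis by (rule that[of u v]) (simp_all add: False r_def u_def v_def diff_divide_distrib add_divide_distrib)
  qed
  have f: "r * x * (r * y) = x * y / 2" for x y using r by Groebner_Basis.algebra
  show "(Re h0)\<^sup>2 + (Re h1)\<^sup>2 + (Re h2)\<^sup>2 = 3 / 2"
    "Re h0 * Re h1 + Re h1 * Re h2 + Re h2 * Re h0 = 0"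
    "Im h0 * Im h1 + Im h1 * Im h2 + Im h2 * Im h0 = 0"
    using p(3) uv unfolding h0_def h1_def h2_def p(1,2) power2_eq_square f
    by (auto simp flip: add_divide_distrib)
qed

lemma balanced_entry:
  assumes "i \<in> set indices"
  shows "balanced (gpart i) (hpart i)"
proof -
  obtain e0 e1 e2 a0 a1 a2 n where i: "i = ((e0, e1, e2), (a0, a1, a2), n)" by (cases i) auto
  let ?d0 = "root3 (zdiff e0 e1)" and ?d1 = "root3 (zdiff e1 e2)" and ?d2 = "root3 (zdiff e2 e0)"
  have d: "root3 x * cnj (root3 y) = root3 (zdiff x y)" for x y
    using cnj_root3_mult[of y x] by (simp add: mult.commute)
  let ?h = "\<lambda>a. eta n * kappa a"
  have B: "balanced (gpart i) (hpart i) \<longleftrightarrow>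
     (Re (?h a0))\<^sup>2 + (Re (?h a1))\<^sup>2 + (Re (?h a2))\<^sup>2 = 3 / 2 \<and>
     ?d0 * (Re (?h a0) * Re (?h a1)) + ?d1 * (Re (?h a1) * Re (?h a2)) + ?d2 * (Re (?h a2) * Re (?h a0)) = 0 \<and>
     ?d0 * (Im (?h a0) * Im (?h a1)) + ?d1 * (Im (?h a1) * Im (?h a2)) + ?d2 * (Im (?h a2) * Im (?h a0)) = 0"
    unfolding balanced_def i gpart_def hpart_def by (simp add: d del: times_complex.sel)
  have "(e0, e1, e2) \<in> {(Z0,Z0,Z0), (Z0,Z1,Z2), (Z0,Z2,Z1)} \<and> (a0, a1, a2) \<in> perms3 \<or>
     (e0, e1, e2) \<in> {(Z0,Z0,Z1), (Z0,Z0,Z2), (Z0,Z1,Z0), (Z0,Z2,Z0), (Z0,Z1,Z1), (Z0,Z2,Z2)}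
       \<and> (a0, a1, a2) = (Z0, Z0, Z0)"
    using assms unfolding i set_indices
    by (simp only: mem_Sigma_iff Un_iff UNIV_I singleton_iff simp_thms)
  then show ?thesis
  proof
    assume A: "(e0, e1, e2) \<in> {(Z0,Z0,Z0), (Z0,Z1,Z2), (Z0,Z2,Z1)} \<and> (a0, a1, a2) \<in> perms3"
    then have "?d1 = ?d0" "?d2 = ?d0" by auto
    then show ?thesis unfolding B using eta_kappa_perm[OF conjunct2[OF A], of n]
      by (simp only: of_real_add[symmetric] of_real_mult[symmetric] distrib_left[symmetric]) simp
  next
    assume A: "(e0, e1, e2) \<in> {(Z0,Z0,Z1), (Z0,Z0,Z2), (Z0,Z1,Z0), (Z0,Z2,Z0), (Z0,Z1,Z1), (Z0,Z2,Z2)}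
       \<and> (a0, a1, a2) = (Z0, Z0, Z0)"
    then have d: "?d0 + ?d1 + ?d2 = 0" using omega3_sum by (auto simp: add_ac)
    have a: "a0 = Z0" "a1 = Z0" "a2 = Z0" using A by auto
    have h: "(Re (?h Z0))\<^sup>2 = 1 / 2" by (cases n) (simp_all add: power2_eq_square)
    show ?thesis unfolding B a using d h by (simp only: distrib_right[symmetric]) simp
  qed
qed

section \<open>Bases unbiased to \<open>B\<^sub>X\<close> and \<open>B\<^sub>Z\<close>\<close>

definition admissible :: "(nat \<Rightarrow> complex) \<Rightarrow> bool" where
  "admissible u \<longleftrightarrow> (\<forall>k<6. cmod (u k) = 1) \<and> (\<forall>j<6. (cmod (fourier_coeff u j))\<^sup>2 = 6)"

lemma fourier_coeff_cong:
  "(\<And>k. k < 6 \<Longrightarrow> u k = u' k) \<Longrightarrow> fourier_coeff u j = fourier_coeff u' j"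
  unfolding fourier_coeff_def by (intro sum.cong) auto

lemma fourier_coeff_mult: "fourier_coeff (\<lambda>k. c * u k) j = c * fourier_coeff u j"
  unfolding fourier_coeff_def by (simp add: sum_distrib_left mult_ac)

lemma admissible_cong: "(\<And>k. k < 6 \<Longrightarrow> u k = u' k) \<Longrightarrow> admissible u \<longleftrightarrow> admissible u'"
  unfolding admissible_def using fourier_coeff_cong[of u u'] by auto

lemma admissible_mult: "cmod c = 1 \<Longrightarrow> admissible (\<lambda>k. c * u k) \<longleftrightarrow> admissible u"
  unfolding admissible_def by (simp add: fourier_coeff_mult norm_mult)

lemma admissible_entry: "i \<in> set indices \<Longrightarrow> admissible (entry i)"
  unfolding admissible_def using entry_unimodular
    flat_iff_balanced[OF gpart_unimodular hpart_unimodular] balanced_entry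
  by (auto simp: entry_def)

lemma admissible_indexed:
  assumes "admissible u"
  shows "indexed u"
proof -
  \<comment> \<open>\<open>4 * b mod 6\<close> is the even position, and
    \<open>(4 * b + 3) mod 6\<close> the odd one, that is congruent to \<open>b\<close> modulo
    3.\<close>
  define p where "p b = u (4 * b mod 6)" for b
  define q where "q b = u ((4 * b + 3) mod 6)" for b
  have un: "u k * cnj (u k) = 1" if "k < 6" for k
    using assms that unfolding admissible_def by (metis complex_norm_square of_real_1 power_one)
  have pp: "p b * cnj (p b) = 1" and qq: "q b * cnj (q b) = 1" for b
    unfolding p_def q_def by (simp_all add: un)
  \<comment> \<open>Either square root would do: the other one changes the sign of
    \<open>g b\<close> as well.\<close>
  define h where "h b = csqrt (p b * cnj (q b))" for b
  define g where "g b = q b * h b" for b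
  have h2: "h b * h b = p b * cnj (q b)" for b
    unfolding h_def by (metis power2_csqrt power2_eq_square)
  have hh: "h b * cnj (h b) = 1" for b
  proof -
    have "cmod (p b) = 1" "cmod (q b) = 1" using pp[of b] qq[of b] by (simp_all add: complex_mod_sqrt_Re_mult_cnj)
    then have "(cmod (h b))\<^sup>2 = 1" using arg_cong[OF h2[of b], of cmod] by (simp add: norm_mult power2_eq_square)
    then show ?thesis by (metis complex_norm_square of_real_1)
  qed
  have gg: "g b * cnj (g b) = 1" for b
    unfolding g_def complex_cnj_mult using hh[of b] qq[of b] by Groebner_Basis.algebra
  have gh: "g b * h b = p b" "g b * cnj (h b) = q b" for b
    unfolding g_def using h2[of b] hh[of b] qq[of b] by Groebner_Basis.algebra+
  have u: "interleave g h k = u k" if "k < 6" for k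
    using less_six_cases[OF that] by (elim insertE emptyE) (simp_all add: interleave_def gh p_def q_def)
  then have "admissible (interleave g h)" using assms admissible_cong[of "interleave g h" u] by simp
  then have "balanced g h" using flat_iff_balanced[of g h, OF gg hh] unfolding admissible_def by simp
  then have "indexed (interleave g h)" by (rule balanced_indexed[OF gg hh])
  then show ?thesis unfolding indexed_def using u by auto
qed

lemma sqrt_6_square: "complex_of_real (sqrt 6) * complex_of_real (sqrt 6) = 6"
  by (simp flip: of_real_mult)

lemma braket_fourier_vec:
  "v \<in> carrier_vec 6 \<Longrightarrow> braket (fourier_vec j) v = fourier_coeff (\<lambda>k. sqrt 6 * v $ k) j / 6"
  using sqrt_6_square
  by (subst braket_sum[of _ 6])
    (auto simp: fourier_vec_def fourier_coeff_def sum_divide_distrib field_simps intro!: sum.cong)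

lemma braket_unit_vec:
  assumes "v \<in> carrier_vec 6" "j < 6"
  shows "braket (unit_vec 6 j) v = v $ j"
proof -
  have "braket (unit_vec 6 j) v = (\<Sum>k<6. if k = j then v $ k else 0)"
    unfolding braket_sum[OF unit_vec_carrier] using assms by (intro sum.cong) auto
  then show ?thesis using assms by simp
qed

text \<open>Scaling by \<open>sqrt 6\<close> makes the entries unimodular. Unbiasedness to the
  standard basis fixes all moduli of the entries, and normalization follows from them.\<close>

lemma unbiased_iff_admissible:
  assumes X: "orthonormal_eigenbasis 6 op_X BX" and Z: "orthonormal_eigenbasis 6 op_Z BZ"
  shows "unbiased 6 v (BX \<union> BZ) \<longleftrightarrow> v \<in> carrier_vec 6 \<and> admissible (\<lambda>k. sqrt 6 * v $ k)"
proof (cases "v \<in> carrier_vec 6")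
  case v: True
  have cF: "cmod (fourier_coeff u j / 6) ^ 2 = 1 / real 6 \<longleftrightarrow> (cmod (fourier_coeff u j))\<^sup>2 = 6" for u j
    by (simp add: norm_divide power_divide)
  have X': "(\<forall>w\<in>BX. (cmod (braket w v))\<^sup>2 = 1 / real 6)
      \<longleftrightarrow> (\<forall>j<6. (cmod (fourier_coeff (\<lambda>k. sqrt 6 * v $ k) j))\<^sup>2 = 6)"
    unfolding cF[symmetric] braket_fourier_vec[OF v, symmetric]
    by (rule eigenbasis_rays[OF X _ _ eigenvector_op_X v, where P = "\<lambda>r. r\<^sup>2 = 1 / real 6"])
      (auto simp: normalized_def braket_fourier, simp add: fourier_vec_def)
  have cU: "(cmod (v $ j))\<^sup>2 = 1 / real 6 \<longleftrightarrow> cmod (sqrt 6 * v $ j) = 1" for j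
  proof -
    have "cmod (sqrt 6 * v $ j) = 1 \<longleftrightarrow> (cmod (sqrt 6 * v $ j))\<^sup>2 = 1"
      by (simp add: power2_eq_1_iff) (use norm_ge_zero in \<open>smt (verit)\<close>)
    also have "(cmod (sqrt 6 * v $ j))\<^sup>2 = 6 * (cmod (v $ j))\<^sup>2" by (simp add: norm_mult power_mult_distrib)
    finally show ?thesis by auto
  qed
  have "normalized (unit_vec 6 j)" if "j < 6" for j
    unfolding normalized_def using that by (simp add: braket_unit_vec)
  then have "(\<forall>w\<in>BZ. (cmod (braket w v))\<^sup>2 = 1 / real 6)
      \<longleftrightarrow> (\<forall>j<6. (cmod (braket (unit_vec 6 j) v))\<^sup>2 = 1 / real 6)"
    by (intro eigenbasis_rays[OF Z _ _ eigenvector_op_Z v, where P = "\<lambda>r. r\<^sup>2 = 1 / real 6"]) auto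
  also have "\<dots> \<longleftrightarrow> (\<forall>j<6. cmod (sqrt 6 * v $ j) = 1)"
    using braket_unit_vec[OF v] cU by auto
  finally have Z': "(\<forall>w\<in>BZ. (cmod (braket w v))\<^sup>2 = 1 / real 6) \<longleftrightarrow> (\<forall>j<6. cmod (sqrt 6 * v $ j) = 1)" .
  have N: "normalized v" if *: "\<forall>j<6. cmod (sqrt 6 * v $ j) = 1"
  proof -
    have "cnj (v $ k) * v $ k = 1 / 6" if "k < 6" for k
    proof -
      have "(cmod (v $ k))\<^sup>2 = 1 / 6" using * cU that by simp
      then show ?thesis by (metis complex_norm_square mult.commute of_real_1 of_real_divide of_real_numeral)
    qed
    then have "(\<Sum>k<6. cnj (v $ k) * v $ k) = (\<Sum>k<(6::nat). 1 / 6)" by (intro sum.cong) auto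
    then show ?thesis unfolding normalized_def braket_sum[OF v] by simp
  qed
  show ?thesis using v N unfolding unbiased_def admissible_def ball_Un X' Z' by blast
qed (simp add: unbiased_def)

text \<open>The factor \<open>cnj (entry i 0)\<close> rotates the first component to the prescribed
  positive value.\<close>

definition mub_vec :: "index \<Rightarrow> complex vec" where
  "mub_vec i = vec 6 (\<lambda>k. cnj (entry i 0) * entry i k / sqrt 6)"

lemma cnj_entry_mult: "cnj (entry i k) * entry i k = 1"
  using entry_unimodular[of i k] by (metis complex_norm_square mult.commute of_real_1 power_one)

lemma mub_vec_simps: "mub_vec i \<in> carrier_vec 6" "mub_vec i $ 0 = complex_of_real (1 / sqrt 6)"
  by (simp_all add: mub_vec_def cnj_entry_mult)

lemma admissible_eq_mub_vec:
  assumes v: "v \<in> carrier_vec 6" and "admissible (\<lambda>k. sqrt 6 * v $ k)"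
  obtains i c where "i \<in> set indices" "cmod c = 1" "v = c \<cdot>\<^sub>v mub_vec i"
proof -
  obtain i c where i: "i \<in> set indices" "cmod c = 1" and c: "\<And>k. k < 6 \<Longrightarrow> sqrt 6 * v $ k = c * entry i k"
    using admissible_indexed[OF assms(2)] unfolding indexed_def by blast
  show thesis
  proof (rule that[OF i(1)])
    show "cmod (c * entry i 0) = 1" using i(2) by (simp add: norm_mult entry_unimodular)
    show "v = (c * entry i 0) \<cdot>\<^sub>v mub_vec i"
    proof (rule eq_vecI)
      fix k assume "k < dim_vec ((c * entry i 0) \<cdot>\<^sub>v mub_vec i)"
      then have k: "k < 6" by (simp add: mub_vec_def)
      have "c * entry i 0 * (cnj (entry i 0) * entry i k / sqrt 6)
        = (cnj (entry i 0) * entry i 0) * (c * entry i k) / sqrt 6" by simp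
      also have "\<dots> = v $ k" unfolding cnj_entry_mult c[OF k, symmetric] by simp
      finally show "v $ k = ((c * entry i 0) \<cdot>\<^sub>v mub_vec i) $ k" using k by (simp add: mub_vec_def)
    qed (use v in \<open>simp add: mub_vec_def\<close>)
  qed
qed

lemma admissible_mub_vec:
  assumes "i \<in> set indices"
  shows "admissible (\<lambda>k. sqrt 6 * mub_vec i $ k)"
proof -
  have "admissible (\<lambda>k. sqrt 6 * mub_vec i $ k) \<longleftrightarrow> admissible (\<lambda>k. cnj (entry i 0) * entry i k)"
    by (rule admissible_cong) (simp add: mub_vec_def)
  also have "\<dots> \<longleftrightarrow> admissible (entry i)"
    by (rule admissible_mult) (simp add: entry_unimodular)
  finally show ?thesis using admissible_entry[OF assms] by simp
qed

lemma braket_mub_vec: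
  "braket (mub_vec i) (mub_vec j)
    = entry i 0 * cnj (entry j 0) / 6 * (\<Sum>k<6. cnj (entry i k) * entry j k)"
  unfolding braket_sum[OF mub_vec_simps(1)] sum_distrib_left
  using sqrt_6_square by (intro sum.cong) (auto simp: mub_vec_def field_simps)

lemma braket_mub_vec_eq_0_iff: "braket (mub_vec i) (mub_vec j) = 0 \<longleftrightarrow> adj i j"
proof -
  have "entry i 0 \<noteq> 0" "entry j 0 \<noteq> 0" using entry_unimodular by (metis norm_zero zero_neq_one)+
  then show ?thesis unfolding braket_mub_vec by (simp add: sum_entry_eq_0_iff)
qed

lemma braket_mub_vec_self: "braket (mub_vec i) (mub_vec i) = 1"
  unfolding braket_mub_vec sum_entry_self using cnj_entry_mult[of i 0] by (simp add: mult.commute)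

lemma braket_commute:
  assumes "v \<in> carrier_vec d" "w \<in> carrier_vec d"
  shows "braket w v = cnj (braket v w)"
  using assms by (simp add: braket_sum mult.commute)

lemma adj_sym: "adj i j \<longleftrightarrow> adj j i"
  unfolding braket_mub_vec_eq_0_iff[symmetric]
  using braket_commute[OF mub_vec_simps(1) mub_vec_simps(1)] by (metis complex_cnj_zero_iff)

lemma distinct_indices: "distinct indices"
  using distinct_neighbourhoods unfolding distinct_map by blast

lemma inj_on_mub_vec: "inj_on mub_vec (set indices)"
proof (rule inj_onI)
  fix i j assume ij: "i \<in> set indices" "j \<in> set indices" and eq: "mub_vec i = mub_vec j"
  then have "adj i = adj j"
    unfolding fun_eq_iff braket_mub_vec_eq_0_iff[symmetric] by simp
  then have "filter (adj i) indices = filter (adj j) indices" by simp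
  then show "i = j" using distinct_neighbourhoods ij unfolding distinct_map inj_on_def by blast
qed

lemma orthonormal_mub_vec_iff:
  assumes "C \<subseteq> set indices"
  shows "orthonormal_basis 6 (mub_vec ` C) \<longleftrightarrow> is_clique adj 6 C"
proof -
  have inj: "inj_on mub_vec C" using inj_on_mub_vec assms by (rule inj_on_subset)
  have fin: "finite C" using assms finite_subset by blast
  show ?thesis
  proof
    assume onb: "orthonormal_basis 6 (mub_vec ` C)"
    have "card C = 6" using orthonormal_basisD(3)[OF onb] card_image[OF inj] by simp
    moreover have "adj i j" if "i \<in> C" "j \<in> C" "i \<noteq> j" for i j
      using onb that inj unfolding orthonormal_basis_def braket_mub_vec_eq_0_iff[symmetric] inj_on_def by blast
    ultimately show "is_clique adj 6 C" using fin by (simp add: is_clique_def)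
  next
    assume C: "is_clique adj 6 C"
    show "orthonormal_basis 6 (mub_vec ` C)"
    proof (rule orthonormal_basisI)
      show "mub_vec ` C \<subseteq> carrier_vec 6" using mub_vec_simps(1) by blast
      show "finite (mub_vec ` C)" using fin by simp
      show "card (mub_vec ` C) = 6" using C card_image[OF inj] by (simp add: is_clique_def)
      show "normalized v" if "v \<in> mub_vec ` C" for v
        using that unfolding normalized_def by (elim imageE) (simp only: braket_mub_vec_self)
      show "braket v w = 0" if "v \<in> mub_vec ` C" "w \<in> mub_vec ` C" "v \<noteq> w" for v w
        using that C unfolding is_clique_def by (elim imageE) (metis braket_mub_vec_eq_0_iff)
    qed
  qed
qed

lemma clique_dominating:
  assumes "C \<subseteq> set indices" "is_clique adj 6 C" "i \<in> set indices"
  obtains j where "j \<in> C" "i = j \<or> adj j i"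
proof -
  have "C \<in> set ` set (cliques adj 6 indices)"
    using set_cliques[OF _ distinct_indices, of adj 6] adj_sym assms(1,2) by blast
  then show thesis
    using that cliques_indices_dominating assms(3) unfolding list_all_iff list_ex_iff by blast
qed

lemma length_indices: "length indices = 48"
  by (simp add: indices_def)

theorem theorem2:
  fixes BX BZ :: "complex vec set"
  assumes "orthonormal_eigenbasis 6 op_X BX"
    and "orthonormal_eigenbasis 6 op_Z BZ"
  shows "let V = {v. unbiased 6 v (BX \<union> BZ) \<and> v $ 0 = complex_of_real (1 / sqrt 6)};
             Bs = {B. B \<subseteq> V \<and> orthonormal_basis 6 B}
         in card V = 48 \<and>
            card Bs = 16 \<and>
            (\<forall>B\<in>Bs. mutually_unbiased 6 BX BZ \<and> mutually_unbiased 6 BX B \<and> mutually_unbiased 6 BZ B) \<and>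
            (\<forall>B\<in>Bs. \<not> (\<exists>\<psi>. unbiased 6 \<psi> BX \<and> unbiased 6 \<psi> BZ \<and> unbiased 6 \<psi> B))"
proof -
  define V where "V = {v. unbiased 6 v (BX \<union> BZ) \<and> v $ 0 = complex_of_real (1 / sqrt 6)}"
  define Bs where "Bs = {B. B \<subseteq> V \<and> orthonormal_basis 6 B}"
  note ub = unbiased_iff_admissible[OF assms]
  have onb: "orthonormal_basis 6 BX" "orthonormal_basis 6 BZ"
    using assms by (simp_all add: orthonormal_eigenbasis_def)
  have V: "V = mub_vec ` set indices"
  proof (intro equalityI subsetI)
    fix v assume "v \<in> V"
    then have v: "v \<in> carrier_vec 6" "admissible (\<lambda>k. sqrt 6 * v $ k)" "v $ 0 = complex_of_real (1 / sqrt 6)"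
      unfolding V_def ub by auto
    obtain i c where i: "i \<in> set indices" "v = c \<cdot>\<^sub>v mub_vec i"
      using admissible_eq_mub_vec[OF v(1,2)] by blast
    have "c * mub_vec i $ 0 = mub_vec i $ 0"
      using v(3) mub_vec_simps[of i] unfolding i(2) by simp
    then have "c = 1" by (simp add: mub_vec_simps(2))
    then show "v \<in> mub_vec ` set indices" using i by simp
  next
    fix v assume "v \<in> mub_vec ` set indices"
    then show "v \<in> V" unfolding V_def ub using mub_vec_simps admissible_mub_vec by auto
  qed
  have Bs: "Bs = (`) mub_vec ` {C. C \<subseteq> set indices \<and> is_clique adj 6 C}"
    unfolding Bs_def V using orthonormal_mub_vec_iff by (auto simp: subset_image_iff)
  have "card V = 48"
    unfolding V card_image[OF inj_on_mub_vec] distinct_card[OF distinct_indices] by (rule length_indices)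
  moreover have "card Bs = 16"
  proof -
    have "inj_on ((`) mub_vec) {C. C \<subseteq> set indices \<and> is_clique adj 6 C}"
      by (rule inj_on_subset[OF inj_on_image_Pow[OF inj_on_mub_vec]]) auto
    then show ?thesis
      unfolding Bs using card_cliques[OF _ distinct_indices, of adj 6] adj_sym length_cliques_indices
      by (simp add: card_image)
  qed
  moreover have "mutually_unbiased 6 BX BZ"
  proof -
    \<comment> \<open>Both bases are arbitrary: \<open>eigenbasis_rays\<close> first replaces
      \<open>BZ\<close> by the standard basis, with a Fourier vector held fixed, and then
      \<open>BX\<close> by the Fourier basis.\<close>
    have XZ: "(cmod (braket v w))\<^sup>2 = 1 / real 6" if "v \<in> BX" "w \<in> BZ" for v w
    proof -
      have v: "v \<in> carrier_vec 6" using onb that orthonormal_basisD(1) by blast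
      have w: "w \<in> carrier_vec 6" using onb that orthonormal_basisD(1) by blast
      have fc: "fourier_vec j \<in> carrier_vec 6" for j by (simp add: fourier_vec_def)
      have "(cmod (braket w (fourier_vec j)))\<^sup>2 = 1 / real 6" if "j < 6" for j
      proof -
        have "cmod omega6 = 1" by (simp add: omega6_eq cmod_def power_divide)
        then have "(cmod (braket (unit_vec 6 k) (fourier_vec j)))\<^sup>2 = 1 / real 6" if "k < 6" for k
          unfolding braket_unit_vec[OF fc that] using that
          by (simp add: fourier_vec_def norm_divide norm_power power_divide)
        moreover have "normalized (unit_vec 6 k)" if "k < 6" for k
          unfolding normalized_def using that by (simp add: braket_unit_vec)
        ultimately have "\<forall>w\<in>BZ. (cmod (braket w (fourier_vec j)))\<^sup>2 = 1 / real 6"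
          by (subst eigenbasis_rays[OF assms(2) _ _ eigenvector_op_Z fc, where P = "\<lambda>r. r\<^sup>2 = 1 / real 6"]) auto
        then show ?thesis using \<open>w \<in> BZ\<close> by blast
      qed
      then have "\<forall>j<6. (cmod (braket (fourier_vec j) w))\<^sup>2 = 1 / real 6"
        by (metis braket_commute[OF fc w] complex_mod_cnj)
      then have "\<forall>v\<in>BX. (cmod (braket v w))\<^sup>2 = 1 / real 6"
        by (subst eigenbasis_rays[OF assms(1) fc _ eigenvector_op_X w, where P = "\<lambda>r. r\<^sup>2 = 1 / real 6"])
          (auto simp: normalized_def braket_fourier)
      then show ?thesis using \<open>v \<in> BX\<close> by blast
    qed
    then show ?thesis unfolding mutually_unbiased_def using onb by blast
  qed
  moreover have "mutually_unbiased 6 BX B" "mutually_unbiased 6 BZ B" if "B \<in> Bs" for B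
    using that onb unfolding Bs_def V_def unbiased_def mutually_unbiased_def by blast+
  moreover have "\<not> (unbiased 6 \<psi> BX \<and> unbiased 6 \<psi> BZ \<and> unbiased 6 \<psi> B)" if "B \<in> Bs" for B \<psi>
  proof
    assume psi: "unbiased 6 \<psi> BX \<and> unbiased 6 \<psi> BZ \<and> unbiased 6 \<psi> B"
    then have "unbiased 6 \<psi> (BX \<union> BZ)" by (auto simp: unbiased_def)
    then obtain i c where i: "i \<in> set indices" and c: "cmod c = 1" "\<psi> = c \<cdot>\<^sub>v mub_vec i"
      using admissible_eq_mub_vec unfolding ub by metis
    obtain C where "C \<in> {C. C \<subseteq> set indices \<and> is_clique adj 6 C}" and C3: "B = mub_vec ` C"
      using \<open>B \<in> Bs\<close> unfolding Bs by (elim imageE)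
    then have C: "C \<subseteq> set indices" "is_clique adj 6 C" by simp_all
    \<comment> \<open>The squared overlap with this basis member is 0 or 1, whereas unbiasedness
      would require 1/6.\<close>
    obtain j where j: "j \<in> C" "i = j \<or> adj j i" using clique_dominating[OF C(1,2) i] .
    have "(cmod (braket (mub_vec j) (mub_vec i)))\<^sup>2 = 1 / 6"
    proof -
      have "(cmod (braket (mub_vec j) \<psi>))\<^sup>2 = 1 / real 6" using psi j(1) C3 by (auto simp: unbiased_def)
      then show ?thesis
        unfolding c(2) braket_smult(2)[OF mub_vec_simps(1) mub_vec_simps(1)] by (simp add: norm_mult c(1))
    qed
    moreover have "braket (mub_vec j) (mub_vec i) = 0 \<or> braket (mub_vec j) (mub_vec i) = 1"
      using j(2) braket_mub_vec_self[of i] braket_mub_vec_eq_0_iff[of j i] by auto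
    ultimately show False by auto
  qed
  ultimately show ?thesis unfolding Let_def V_def[symmetric] Bs_def[symmetric] by blast
qed

end
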